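(* Let $L,M,t\geq1$ be integers. Put $$c_0^+(0,t,\mathbf{1}_L,\mathbf{1}_M):=\frac{\pi\log(t)}{M}\prod_{p\mid L}(1-p^{-1})\prod_{p\mid M}(1-p^{-1}),$$ and for $n>0$ put $$c_0^+(n,t,\mathbf{1}_L,\mathbf{1}_M):=\frac{\pi}{M^2}n^{-1}\left(\sigma_1^{\mathbf{1}_L,\mathbf{1}_M}(n)-t\,\sigma_1^{\mathbf{1}_L,\mathbf{1}_M}\!\left(\frac{n}{t}\right)\right).$$ Then the series $G_0^{\mathbf{1}_L,\mathbf{1}_M,t}(z):=\sum_{n=0}^\infty c_0^+(n,t,\mathbf{1}_L,\mathbf{1}_M)q^n$ is a mock modular form of weight $0$, level $tLM$ and trivial character with shadow $E_2^{\mathbf{1}_L,\mathbf{1}_M,t}(z)$.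
   Context: Notation: $\mathbb{H}$ is the upper half-plane, $z=x+iy$, $q=e^{2\pi i z}$, $\Gamma_0(N)=\{\pm\left(\begin{smallmatrix}a&b\\c&d\end{smallmatrix}\right)\in\mathrm{PSL}_2(\mathbb{Z}):N\mid c\}$. $\mathbf{1}_N$ denotes the trivial Dirichlet character mod $N$. A function $f$ on $\mathbb{H}$ transforms with weight $j$, level $N$, character $\chi$ if $f(\gamma z)=\chi(d)(cz+d)^jf(z)$ for all $\gamma\in\Gamma_0(N)$. $H_0(N,\chi)$ denotes the space of real-analytic $F:\mathbb{H}\to\mathbb{C}$ transforming with weight $0$, level $N$, character $\chi$, with $y^2(\partial_x^2+\partial_y^2)F=0$, at most linear exponential growth at the cusps, and with $\xi_0F$ holomorphic at every cusp, where $\xi_0:=2i\,\overline{\partial_{\bar z}}$. Every such $F$ has an expansion $F=\sum_{n\ge n_0}c^+(n)q^n-\sum_{n\ge0}\overline{c(n)}\beta_0(n,y)q^{-n}$ with $\beta_0(n,y)=\int_y^\infty e^{-4\pi nu}u^{0}\,\frac{du}{u^{2}}\cdot u^{2}$ — i.e. $\beta_{2-k}(n,y)=\int_y^\infty e^{-4\pi nu}u^{k-2}du$ with $k=2$ — for $n>0$ and $\beta_0(0,y)=-y$; then $\xi_0F=\sum c(n)q^n$. A series $g$ is a mock modular form of weight $0$, level $N$, character $\chi$ with shadow $f$ if $g=\sum_{n\ge n_0}c^+(n)q^n$ is the holomorphic part of some $F\in H_0(N,\chi)$ with $\xi_0F=f$. For a Dirichlet character $\varrho$ mod $M$: $\varrho^0$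 is the primitive character inducing it, $m_\varrho$ its conductor, $\ell_\varrho=M/m_\varrho$; $\mu$ is the Möbius function; arithmetic functions are $0$ at non-positive-integers or non-integers. For characters $\psi$ mod $L$, $\varrho$ mod $M$, $$\sigma^{\psi,\varrho}_{1}(n):=\sum_{0<c\mid n}\psi\!\left(\tfrac{n}{c}\right)c\sum_{0<d\mid\gcd(\ell_\varrho,c)}d\,\mu\!\left(\tfrac{\ell_\varrho}{d}\right)\overline{\varrho^0}\!\left(\tfrac{\ell_\varrho}{d}\right)\varrho^0\!\left(\tfrac{c}{d}\right).$$ Let $C_2(\mathbf{1}_L,\mathbf{1}_M):=L(2,\mathbf{1}_M)=\sum_{n\ge1}\mathbf{1}_M(n)n^{-2}$ if $L=1$ and $0$ if $L>1$. Define $$E_2^{\mathbf{1}_L,\mathbf{1}_M}(z):=C_2(\mathbf{1}_L,\mathbf{1}_M)-\frac{\pi}{2My}\prod_{p\mid M}(1-p^{-1})\prod_{p\mid L}(1-p^{-1})-\frac{4\pi^2}{M^2}\sum_{n\ge1}\sigma_1^{\mathbf{1}_L,\mathbf{1}_M}(n)q^n,$$ and $E_2^{\mathbf{1}_L,\mathbf{1}_M,t}(z):=E_2^{\mathbf{1}_L,\mathbf{1}_M}(z)-tE_2^{\mathbf{1}_L,\mathbf{1}_M}(tz)$, a holomorphic modular form of weight $2$ for $\Gamma_0(tLM)$ with trivial character. *)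

theory Defs
  imports
    "HOL-Complex_Analysis.Complex_Analysis"
    "HOL-Computational_Algebra.Squarefree"
begin

section \<open>Dirichlet characters and divisor sums\<close>

definition dirichlet_character :: "nat \<Rightarrow> (int \<Rightarrow> complex) \<Rightarrow> bool" where
  "dirichlet_character M chi \<longleftrightarrow> M > 0 \<and> chi 1 = 1 \<and>
     (\<forall>a b. chi (a * b) = chi a * chi b) \<and>
     (\<forall>a. chi (a + int M) = chi a) \<and>
     (\<forall>a. chi a \<noteq> 0 \<longleftrightarrow> coprime a (int M))"

definition trivial_character :: "nat \<Rightarrow> int \<Rightarrow> complex" where
  "trivial_character M a = (if coprime a (int M) then 1 else 0)"

text \<open>A character mod \<open>m\<close> induces a character mod \<open>M\<close> if \<open>m dvd M\<close> and the two agree on all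
  integers coprime to \<open>M\<close>. The modulus is passed explicitly, since a function does not
  determine it.\<close>

definition induces :: "nat \<Rightarrow> (int \<Rightarrow> complex) \<Rightarrow> nat \<Rightarrow> (int \<Rightarrow> complex) \<Rightarrow> bool" where
  "induces m chi' M chi \<longleftrightarrow> dirichlet_character m chi' \<and> m dvd M \<and>
     (\<forall>a. coprime a (int M) \<longrightarrow> chi a = chi' a)"

definition character_conductor :: "nat \<Rightarrow> (int \<Rightarrow> complex) \<Rightarrow> nat" where
  "character_conductor M chi = (LEAST m. \<exists>chi'. induces m chi' M chi)"

definition primitive_inducing :: "nat \<Rightarrow> (int \<Rightarrow> complex) \<Rightarrow> int \<Rightarrow> complex" where
  "primitive_inducing M chi = (THE chi'. induces (character_conductor M chi) chi' M chi)"

lemma dirichlet_character_trivial: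
  assumes "M > 0"
  shows "dirichlet_character M (trivial_character M)"
proof -
  have "coprime (a + int M) (int M) \<longleftrightarrow> coprime a (int M)" for a
    by (simp only: coprime_iff_gcd_eq_1 gcd_add1)
  then show ?thesis
    using assms by (simp add: dirichlet_character_def trivial_character_def)
qed

definition moebius_mu :: "nat \<Rightarrow> int" where
  "moebius_mu n = (if squarefree n then (-1) ^ card (prime_factors n) else 0)"

text \<open>Extension of an arithmetic function by \<open>0\<close> to all rationals that are not positive
  integers.\<close>

definition arith_extend :: "(nat \<Rightarrow> complex) \<Rightarrow> rat \<Rightarrow> complex" where
  "arith_extend f x = (if x \<in> \<int> \<and> x > 0 then f (nat \<lfloor>x\<rfloor>) else 0)"

text \<open>Here \<open>\<rho>\<close> is a character mod \<open>M\<close>, \<open>\<rho>0\<close> the primitive character inducing it and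
  \<open>l\<close> the quotient of \<open>M\<close> by the conductor of \<open>\<rho>\<close>. All divisions are exact.\<close>

definition sigma1 :: "(int \<Rightarrow> complex) \<Rightarrow> nat \<Rightarrow> (int \<Rightarrow> complex) \<Rightarrow> nat \<Rightarrow> complex" where
  "sigma1 \<psi> M \<rho> n = (if n = 0 then 0 else
     (let l = M div character_conductor M \<rho>; \<rho>0 = primitive_inducing M \<rho> in
       \<Sum>c | c > 0 \<and> c dvd n. \<psi> (int (n div c)) * of_nat c *
         (\<Sum>d | d > 0 \<and> d dvd gcd l c.
            of_nat d * of_int (moebius_mu (l div d)) *
            cnj (\<rho>0 (int (l div d))) * \<rho>0 (int (c div d)))))"

abbreviation sigma1_triv :: "nat \<Rightarrow> nat \<Rightarrow> nat \<Rightarrow> complex" where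
  "sigma1_triv L M \<equiv> sigma1 (trivial_character L) M (trivial_character M)"


section \<open>The upper half-plane and the action of the modular group\<close>

definition upper_half_plane :: "complex set" where
  "upper_half_plane = {z. Im z > 0}"

definition qexp :: "complex \<Rightarrow> complex" where
  "qexp z = exp (2 * of_real pi * \<i> * z)"

text \<open>\<open>(a, b, c, d)\<close> stands for the matrix with rows \<open>(a, b)\<close> and \<open>(c, d)\<close>. Both
  representatives of an element of \<open>PSL\<^sub>2(\<int>)\<close> are included, so a condition imposed on all
  elements below is imposed on both of them. The full modular group is \<open>Gamma0 1\<close>.\<close>

definition Gamma0 :: "nat \<Rightarrow> (int \<times> int \<times> int \<times> int) set" where
  "Gamma0 N = {(a, b, c, d). a * d - b * c = 1 \<and> int N dvd c}"

definition mobius :: "int \<times> int \<times> int \<times> int \<Rightarrow> complex \<Rightarrow> complex" where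
  "mobius = (\<lambda>(a, b, c, d) z. (of_int a * z + of_int b) / (of_int c * z + of_int d))"

definition transforms_with ::
    "int \<Rightarrow> nat \<Rightarrow> (int \<Rightarrow> complex) \<Rightarrow> (complex \<Rightarrow> complex) \<Rightarrow> bool" where
  "transforms_with j N chi f \<longleftrightarrow> (\<forall>(a, b, c, d) \<in> Gamma0 N. \<forall>z \<in> upper_half_plane.
     f (mobius (a, b, c, d) z) = chi d * (of_int c * z + of_int d) powi j * f z)"


section \<open>Differential operators and analyticity in two real variables\<close>

definition partial_x :: "(complex \<Rightarrow> complex) \<Rightarrow> complex \<Rightarrow> complex" where
  "partial_x F z = vector_derivative (\<lambda>s. F (z + of_real s)) (at 0)"

definition partial_y :: "(complex \<Rightarrow> complex) \<Rightarrow> complex \<Rightarrow> complex" where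
  "partial_y F z = vector_derivative (\<lambda>s. F (z + \<i> * of_real s)) (at 0)"

definition partial_zbar :: "(complex \<Rightarrow> complex) \<Rightarrow> complex \<Rightarrow> complex" where
  "partial_zbar F z = (partial_x F z + \<i> * partial_y F z) / 2"

definition xi0 :: "(complex \<Rightarrow> complex) \<Rightarrow> complex \<Rightarrow> complex" where
  "xi0 F z = 2 * \<i> * cnj (partial_zbar F z)"

definition real_analytic_on :: "(complex \<Rightarrow> complex) \<Rightarrow> complex set \<Rightarrow> bool" where
  "real_analytic_on F S \<longleftrightarrow> (\<forall>z \<in> S. \<exists>r > 0. \<exists>a :: nat \<times> nat \<Rightarrow> complex.
     \<forall>x y :: real. \<bar>x\<bar> < r \<and> \<bar>y\<bar> < r \<longrightarrow>
       ((\<lambda>(i, j). a (i, j) * of_real x ^ i * of_real y ^ j) has_sum F (z + Complex x y)) UNIV)"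


section \<open>Harmonic functions of weight 0 and mock modular forms\<close>

text \<open>The cusps are represented by the translates of \<open>\<infinity>\<close> under the full modular group.
  The growth bound is uniform in the real part.\<close>

definition linear_exp_growth_at_cusps :: "(complex \<Rightarrow> complex) \<Rightarrow> bool" where
  "linear_exp_growth_at_cusps F \<longleftrightarrow> (\<forall>\<gamma> \<in> Gamma0 1. \<exists>C :: real.
     (\<lambda>z. norm (F (mobius \<gamma> z))) \<in> O[filtercomap Im at_top](\<lambda>z. exp (C * Im z)))"

definition holomorphic_at_cusps :: "int \<Rightarrow> (complex \<Rightarrow> complex) \<Rightarrow> bool" where
  "holomorphic_at_cusps k f \<longleftrightarrow> (\<forall>(a, b, c, d) \<in> Gamma0 1.
     \<exists>h :: nat. h > 0 \<and> (\<exists>coef :: nat \<Rightarrow> complex. \<forall>z \<in> upper_half_plane.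
       (\<lambda>n. coef n * qexp (of_nat n * z / of_nat h)) sums
         ((of_int c * z + of_int d) powi (-k) * f (mobius (a, b, c, d) z))))"

definition H0 :: "nat \<Rightarrow> (int \<Rightarrow> complex) \<Rightarrow> (complex \<Rightarrow> complex) set" where
  "H0 N chi = {F. real_analytic_on F upper_half_plane \<and>
     transforms_with 0 N chi F \<and>
     (\<forall>z \<in> upper_half_plane.
        of_real ((Im z)\<^sup>2) * (partial_x (partial_x F) z + partial_y (partial_y F) z) = 0) \<and>
     linear_exp_growth_at_cusps F \<and>
     holomorphic_at_cusps 2 (xi0 F)}"

text \<open>The general integrand is \<open>exp (- 4 \<pi> n u) u\<^bsup>k-2\<^esup>\<close>, with \<open>k = 2\<close>.\<close>

definition beta0 :: "nat \<Rightarrow> real \<Rightarrow> real" where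
  "beta0 n y = (if n = 0 then - y else integral {y..} (\<lambda>u. exp (- 4 * pi * of_nat n * u)))"

text \<open>A \<open>q\<close>-series with finitely many negative exponents is given as a formal Laurent
  series. The coefficients \<open>c\<close> below are those of \<open>\<xi>\<^sub>0 F\<close>.\<close>

definition is_holomorphic_part :: "complex fls \<Rightarrow> (complex \<Rightarrow> complex) \<Rightarrow> bool" where
  "is_holomorphic_part g F \<longleftrightarrow> fls_conv_radius g \<ge> 1 \<and>
     (\<exists>c :: nat \<Rightarrow> complex. \<forall>z \<in> upper_half_plane.
        summable (\<lambda>n. cnj (c n) * of_real (beta0 n (Im z)) * qexp z powi (- int n)) \<and>
        F z = eval_fls g (qexp z) -
              (\<Sum>n. cnj (c n) * of_real (beta0 n (Im z)) * qexp z powi (- int n)))"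

definition mock_modular_form_weight0 ::
    "nat \<Rightarrow> (int \<Rightarrow> complex) \<Rightarrow> complex fls \<Rightarrow> (complex \<Rightarrow> complex) \<Rightarrow> bool" where
  "mock_modular_form_weight0 N chi g shadow \<longleftrightarrow>
     (\<exists>F \<in> H0 N chi. is_holomorphic_part g F \<and> (\<forall>z \<in> upper_half_plane. xi0 F z = shadow z))"


section \<open>The Eisenstein series of weight 2 and its mock modular preimage\<close>

definition euler_prod :: "nat \<Rightarrow> complex" where
  "euler_prod N = (\<Prod>p | prime p \<and> p dvd N. 1 - 1 / of_nat p)"

definition C2 :: "nat \<Rightarrow> nat \<Rightarrow> complex" where
  "C2 L M = (if L = 1 then (\<Sum>n. trivial_character M (int (Suc n)) / of_nat (Suc n) ^ 2) else 0)"

definition E2 :: "nat \<Rightarrow> nat \<Rightarrow> complex \<Rightarrow> complex" where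
  "E2 L M z = C2 L M
     - of_real pi / (2 * of_nat M * of_real (Im z)) * euler_prod M * euler_prod L
     - 4 * of_real pi ^ 2 / of_nat M ^ 2 * (\<Sum>n. sigma1_triv L M (Suc n) * qexp z ^ Suc n)"

definition E2t :: "nat \<Rightarrow> nat \<Rightarrow> nat \<Rightarrow> complex \<Rightarrow> complex" where
  "E2t L M t z = E2 L M z - of_nat t * E2 L M (of_nat t * z)"

definition c0_plus :: "nat \<Rightarrow> nat \<Rightarrow> nat \<Rightarrow> nat \<Rightarrow> complex" where
  "c0_plus L M t n = (if n = 0
     then of_real (pi * ln (of_nat t)) / of_nat M * euler_prod L * euler_prod M
     else of_real pi / of_nat M ^ 2 * (1 / of_nat n) *
       (sigma1_triv L M n - of_nat t * arith_extend (sigma1_triv L M) (of_nat n / of_nat t)))"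

definition G0 :: "nat \<Rightarrow> nat \<Rightarrow> nat \<Rightarrow> complex fls" where
  "G0 L M t = fps_to_fls (Abs_fps (c0_plus L M t))"

end

(*
  The function H z = ln (Im z) + 4 ln |eta z|, with eta the Dedekind eta function, is invariant
  under the full modular group, and xi_0 maps H (m z) / m to - pi / 3 times E2 (m z), where E2 is
  the non-holomorphic Eisenstein series 1 - 3 / (pi y) - 24 sum sigma n q^n. Opening up the
  Ramanujan sum in sigma_1 and the coprimality condition modulo L by Moebius inversion writes
  E2^{1_L, 1_M} as a combination of the functions E2 (d e z) with d | M and e | L. Hence the
  preimage of E2^{1_L, 1_M, t} is the corresponding combination of the differences
  H (d e z) - H (t d e z), in which the logarithms of Im z cancel. Its q-expansion is read off
  from the Euler product of eta. The constant c_0^+(0) is twice the constant term obtained in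
  this way; this is harmless, because constants lie in H_0 (N, 1_N) and are killed by xi_0.

  The invariance of H under z -> -1/z is proved on the imaginary axis, where it amounts to the
  failure of a lattice sum to be independent of the order of summation, and follows everywhere
  by analytic continuation.
*)
theory Submission
  imports Defs "HOL-Real_Asymp.Real_Asymp"
begin

section \<open>A conditionally convergent lattice sum\<close>

text \<open>Because the weights come in pairs of opposite sign, what remains after the cancellation
  is \<open>g + cnj g\<close> with g holomorphic. Real analyticity, harmonicity and the shadow thus
  reduce to complex derivatives of g. The obstacle is that membership in H_0 concerns every cusp,
  where the arguments d e z are moved by matrices outside Gamma_0(N). As H is invariant under the
  full modular group, bringing diag(m, 1) gamma to triangular form replaces H (m gamma z) by H ((A z
  + B) / D) with A D = m. The combination keeps its shape, and the same estimates serve at all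
  cusps. On the imaginary axis the lattice sum is a real double sum of Re (n + i m y)^-2. Once the
  columns n \<le> N are removed, row m has a tail close to N / (N^2 + (m y)^2). Each tail tends to
  0, but together they form a Riemann sum for arctan and tend to pi / (2 y). This mass escaping to
  infinity is the source of the term 6 / (pi y) in the transformation law of E_2.\<close>

lemma Digamma_reflection:
  fixes z :: complex
  assumes "z \<notin> \<int>"
  shows "Digamma (1 - z) - Digamma z = of_real pi * cot (of_real pi * z)"
proof -
  have z: "z \<notin> \<int>\<^sub>\<le>\<^sub>0" "1 - z \<notin> \<int>\<^sub>\<le>\<^sub>0"
    using assms Ints_diff[of 1 "1 - z"] by (auto dest: nonpos_Ints_Int)
  have s: "sin (of_real pi * z) \<noteq> 0"
    using assms by (auto simp: sin_eq_0 mult.commute)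
  \<comment> \<open>Both sides of Euler's reflection formula are differentiated; dividing by the
    nonzero product \<open>Gamma z * Gamma (1 - z)\<close> then leaves the claim.\<close>
  have "((\<lambda>z. Gamma z * Gamma (1 - z)) has_field_derivative
      (Gamma z * Digamma z * Gamma (1 - z) - Gamma z * (Gamma (1 - z) * Digamma (1 - z)))) (at z)"
    using z by (auto intro!: derivative_eq_intros)
  moreover have "((\<lambda>z. of_real pi / sin (of_real pi * z)) has_field_derivative
      (- of_real pi * (cos (of_real pi * z) * of_real pi) / (sin (of_real pi * z))\<^sup>2)) (at z)"
    using s by (auto intro!: derivative_eq_intros simp: power2_eq_square)
  ultimately have e: "Gamma z * Digamma z * Gamma (1 - z) - Gamma z * (Gamma (1 - z) * Digamma (1 - z)) =
     - of_real pi * (cos (of_real pi * z) * of_real pi) / (sin (of_real pi * z))\<^sup>2"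
    by (intro DERIV_unique[of "\<lambda>z. Gamma z * Gamma (1 - z)"])
       (simp_all add: Gamma_reflection_complex)
  have "(Gamma z * Gamma (1 - z)) * (Digamma z - Digamma (1 - z)) =
     Gamma z * Digamma z * Gamma (1 - z) - Gamma z * (Gamma (1 - z) * Digamma (1 - z))"
    by (simp add: algebra_simps)
  also have "\<dots> = (Gamma z * Gamma (1 - z)) * (- (of_real pi * cot (of_real pi * z)))"
    unfolding e by (simp add: Gamma_reflection_complex cot_def power2_eq_square)
  finally have "(Gamma z * Gamma (1 - z)) * (Digamma z - Digamma (1 - z)) =
     (Gamma z * Gamma (1 - z)) * (- (of_real pi * cot (of_real pi * z)))" .
  moreover have "Gamma z * Gamma (1 - z) \<noteq> 0"
    using s by (simp add: Gamma_reflection_complex)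
  ultimately have "Digamma z - Digamma (1 - z) = - (of_real pi * cot (of_real pi * z))"
    by (rule mult_left_cancel[THEN iffD1, rotated])
  then show ?thesis
    by (metis minus_diff_eq minus_minus)
qed

text \<open>The derivative of the preceding identity. The two series of \<open>Polygamma 1\<close>
  together run over all integers, so this is the partial fraction expansion of pi^2 / sin^2.\<close>

lemma Trigamma_reflection:
  fixes z :: complex
  assumes "z \<notin> \<int>"
  shows "Polygamma 1 z + Polygamma 1 (1 - z) = (of_real pi / sin (of_real pi * z))\<^sup>2"
proof -
  have z: "z \<notin> \<int>\<^sub>\<le>\<^sub>0" "1 - z \<notin> \<int>\<^sub>\<le>\<^sub>0"
    using assms Ints_diff[of 1 "1 - z"] by (auto dest: nonpos_Ints_Int)
  have s: "sin (of_real pi * z) \<noteq> 0"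
    using assms by (auto simp: sin_eq_0 mult.commute)
  have "((\<lambda>z. Digamma (1 - z) - Digamma z) has_field_derivative
      (- Polygamma 1 (1 - z) - Polygamma 1 z)) (at z)"
    using z by (auto intro!: derivative_eq_intros)
  moreover have "((\<lambda>z. of_real pi * cot (of_real pi * z)) has_field_derivative
      (- ((of_real pi / sin (of_real pi * z))\<^sup>2))) (at z)"
    using s by (auto intro!: derivative_eq_intros DERIV_cot[THEN DERIV_chain2] simp: power2_eq_square field_simps)
  moreover have "((\<lambda>z. of_real pi * cot (of_real pi * z)) has_field_derivative
      (- Polygamma 1 (1 - z) - Polygamma 1 z)) (at z)"
    by (rule has_field_derivative_transform_within_open[OF calculation(1), where S = "- \<int>"])
       (use assms Digamma_reflection in \<open>auto intro: open_Compl\<close>)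
  ultimately have "- Polygamma 1 (1 - z) - Polygamma 1 z = - ((of_real pi / sin (of_real pi * z))\<^sup>2)"
    by (blast intro: DERIV_unique)
  then show ?thesis
    by (simp add: algebra_simps minus_equation_iff)
qed

section \<open>Rows of the lattice sum and their tails\<close>

text \<open>This is the real part of \<open>1 / (v + \<i> u)\<^sup>2\<close>.\<close>

definition lattice_kernel :: "real \<Rightarrow> real \<Rightarrow> real" where
  "lattice_kernel u v = (v\<^sup>2 - u\<^sup>2) / (u\<^sup>2 + v\<^sup>2)\<^sup>2"

text \<open>Half of (pi / sin (pi z))^2 - 1 / z^2 at z = i u, that is, half the sum of (z + n)^-2
  over all nonzero integers n. The terms for n and -n are conjugate, so each pair contributes twice
  the kernel.\<close>

definition lattice_kernel_sum :: "real \<Rightarrow> real" where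
  "lattice_kernel_sum u = (1 / u\<^sup>2 - (pi / sinh (pi * u))\<^sup>2) / 2"

lemma sin_i_times_of_real: "sin (\<i> * of_real x) = \<i> * of_real (sinh x :: real)"
  by (simp add: sin_i_times sinh_def scaleR_conv_of_real exp_minus flip: exp_of_real)

lemma lattice_kernel_sums:
  assumes "u > 0"
  shows "(\<lambda>n. lattice_kernel u (real (Suc n))) sums lattice_kernel_sum u"
proof -
  define z where "z = \<i> * complex_of_real u"
  have z: "z \<notin> \<int>" "z \<noteq> 0" "1 - z \<noteq> 0"
    using assms by (auto simp: z_def complex_eq_iff elim!: Ints_cases)
  have 1: "(\<lambda>k. inverse ((w + of_nat k)^2)) sums Polygamma 1 w" if "w \<noteq> 0" for w :: complex
    using Polygamma_LIMSEQ[of w 1] that by (simp add: power2_eq_square)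
  have "(\<lambda>k. inverse ((z + of_nat k)^2)) sums Polygamma 1 z" by (rule 1) fact
  \<comment> \<open>Dropping the term 1 / z^2 aligns this series with the one at
    \<open>1 - z\<close>: both are now indexed by n = k + 1, with terms (n + z)^-2 and (n -
    z)^-2.\<close>
  then have "(\<lambda>k. inverse ((z + of_nat (Suc k))^2)) sums (Polygamma 1 z - inverse (z^2))"
    by (subst sums_Suc_iff) simp
  from sums_add[OF this 1[OF z(3)]]
  have "(\<lambda>k. inverse ((z + of_nat (Suc k))^2) + inverse ((1 - z + of_nat k)^2)) sums
     ((of_real pi / sin (of_real pi * z))\<^sup>2 - inverse (z^2))"
    using Trigamma_reflection[OF z(1)] by (simp add: algebra_simps)
  also have "(of_real pi / sin (of_real pi * z))\<^sup>2 - inverse (z^2) = 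
     of_real (2 * lattice_kernel_sum u)"
    using sin_i_times_of_real[of "pi * u"]
    by (simp add: z_def lattice_kernel_sum_def power_mult_distrib field_simps)
  also have "(\<lambda>k. inverse ((z + of_nat (Suc k))^2) + inverse ((1 - z + of_nat k)^2)) =
     (\<lambda>k. of_real (2 * lattice_kernel u (real (Suc k))))"
  proof
    fix k
    define n where "n = complex_of_real (real (Suc k))"
    define v where "v = complex_of_real u"
    have ne: "n + z \<noteq> 0" "n - z \<noteq> 0" "n^2 + v^2 \<noteq> 0"
    proof -
      show "n + z \<noteq> 0" "n - z \<noteq> 0" using assms by (auto simp: n_def z_def complex_eq_iff)
      moreover have "n^2 + v^2 = (n + z) * (n - z)"
        by (simp add: z_def v_def algebra_simps power2_eq_square)
      ultimately show "n^2 + v^2 \<noteq> 0" by simp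
    qed
    have "inverse ((n + z)^2) + inverse ((n - z)^2) = ((n - z)^2 + (n + z)^2) / ((n + z) * (n - z))^2"
      using ne(1,2) unfolding power_mult_distrib by (simp add: divide_simps)
    also have "(n - z)^2 + (n + z)^2 = 2 * (n^2 - v^2)"
      by (simp add: z_def v_def algebra_simps power2_eq_square)
    also have "(n + z) * (n - z) = v^2 + n^2"
      by (simp add: z_def v_def algebra_simps power2_eq_square)
    finally show "inverse ((z + of_nat (Suc k))^2) + inverse ((1 - z + of_nat k)^2) =
        of_real (2 * lattice_kernel u (real (Suc k)))"
      by (simp add: lattice_kernel_def n_def v_def algebra_simps)
  qed
  finally have "(\<lambda>k. 2 * lattice_kernel u (real (Suc k))) sums (2 * lattice_kernel_sum u)"
    using sums_of_real_iff by blast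
  then show ?thesis using sums_mult_iff[of "2::real"] by simp
qed

text \<open>The main term is the integral of the kernel over \<open>v \<ge> N\<close>.\<close>

lemma lattice_kernel_tail:
  assumes "u > 0"
  shows "\<bar>lattice_kernel_sum u - (\<Sum>n<N. lattice_kernel u (real (Suc n))) - real N / ((real N)\<^sup>2 + u\<^sup>2)\<bar>
           \<le> 3 / ((real N)\<^sup>2 + u\<^sup>2)"
proof -
  \<comment> \<open>An antiderivative of the kernel in v is - v / (v^2 + u^2), so
    \<open>f n - f (Suc n)\<close> is the integral over one step. The error bound \<open>g\<close>
    is shaped so that it telescopes too.\<close>
  define f where "f n = real n / (real n^2 + u^2)" for n
  define g where "g n = 3 / (real n^2 + u^2)" for n
  have lim: "f \<longlonglongrightarrow> 0" "g \<longlonglongrightarrow> 0"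
    unfolding f_def g_def by real_asymp+
  have s1: "(\<lambda>n. lattice_kernel u (real (Suc (n + N)))) sums (lattice_kernel_sum u - (\<Sum>n<N. lattice_kernel u (real (Suc n))))"
    using lattice_kernel_sums[OF assms] by (subst sums_iff_shift) simp
  have s2: "(\<lambda>n. f (n + N) - f (Suc (n + N))) sums (f N - 0)"
    using telescope_sums'[OF LIMSEQ_ignore_initial_segment[OF lim(1), of N]] by simp
  have s3: "(\<lambda>n. g (n + N) - g (Suc (n + N))) sums (g N - 0)"
    using telescope_sums'[OF LIMSEQ_ignore_initial_segment[OF lim(2), of N]] by simp
  have bd: "\<bar>lattice_kernel u (real (Suc n)) - (f n - f (Suc n))\<bar> \<le> g n - g (Suc n)" for n
  proof -
    define a where "a = real n"
    define b where "b = real (Suc n)"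
    have ab: "b = a + 1" "a \<ge> 0" by (auto simp: a_def b_def)
    define P where "P = a^2 + u^2" define Q where "Q = b^2 + u^2"
    have PQ: "P > 0" "Q > 0" using assms by (auto simp: P_def Q_def add_nonneg_pos)
    have "f n - f (Suc n) - lattice_kernel u (real (Suc n)) = a / P - b / Q - (b^2 - u^2) / Q^2"
      by (simp add: f_def lattice_kernel_def P_def Q_def a_def b_def add.commute)
    also have "\<dots> = ((a * Q - b * P) * Q - (b^2-u^2) * P) / (P * Q^2)"
      using PQ by (simp add: field_simps power2_eq_square)
    also have "(a * Q - b * P) * Q - (b^2-u^2) * P = a * b^2 - u^2 * (a + 2 * b)"
      unfolding P_def Q_def ab(1) by (simp add: algebra_simps power2_eq_square)
    finally have e: "f n - f (Suc n) - lattice_kernel u (real (Suc n)) = (a * b^2 - u^2 * (a + 2 * b)) / (P * Q^2)" .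
    have "\<bar>a * b^2 - u^2 * (a + 2 * b)\<bar> \<le> \<bar>a * b^2\<bar> + \<bar>u^2 * (a + 2 * b)\<bar>" by (rule abs_triangle_ineq4)
    also have "\<dots> = a * b^2 + u^2 * (a + 2 * b)" using ab by simp
    also have "\<dots> \<le> (3 * b) * b^2 + u^2 * (3 * b)"
      using ab by (intro add_mono mult_mono mult_left_mono) auto
    also have "\<dots> = 3 * b * Q" by (simp add: Q_def algebra_simps)
    finally have "\<bar>f n - f (Suc n) - lattice_kernel u (real (Suc n))\<bar> \<le> 3 * b * Q / (P * Q^2)"
      unfolding e using PQ by (simp add: divide_right_mono)
    also have "\<dots> = 3 * b / (P * Q)" using PQ by (simp add: power2_eq_square field_simps)
    \<comment> \<open>Since b = a + 1, Q - P = a + b \<ge> b; this turns the bound into 3 / P - 3 /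
      Q.\<close>
    also have "\<dots> \<le> 3 * (Q - P) / (P * Q)"
    proof (intro divide_right_mono)
      show "3 * b \<le> 3 * (Q - P)" using ab by (simp add: P_def Q_def power2_eq_square algebra_simps)
    qed (use PQ in simp)
    also have "\<dots> = g n - g (Suc n)"
      using PQ unfolding g_def a_def[symmetric] b_def[symmetric] P_def[symmetric] Q_def[symmetric]
      by (simp add: field_simps)
    finally show ?thesis by (simp add: abs_minus_commute)
  qed
  have "\<bar>lattice_kernel_sum u - (\<Sum>n<N. lattice_kernel u (real (Suc n))) - f N\<bar> \<le> g N"
  proof -
    note d = sums_diff[OF s1 s2]
    have "lattice_kernel_sum u - (\<Sum>n<N. lattice_kernel u (real (Suc n))) - (f N - 0) \<le> g N - 0"
      by (rule sums_le[OF _ d s3]) (rule abs_le_D1[OF bd])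
    moreover have "-(lattice_kernel_sum u - (\<Sum>n<N. lattice_kernel u (real (Suc n))) - (f N - 0)) \<le> g N - 0"
      by (rule sums_le[OF _ sums_minus[OF d] s3]) (rule abs_le_D2[OF bd])
    ultimately show ?thesis by simp
  qed
  then show ?thesis by (simp add: f_def g_def)
qed

section \<open>Comparison of the two orders of summation\<close>

lemma lattice_row_summable:
  fixes y c :: real
  assumes "y > 0"
  shows "summable (\<lambda>m. 1 / (c\<^sup>2 + (real (Suc m) * y)\<^sup>2))"
proof (rule summable_comparison_test')
  have "summable (\<lambda>m. 1 / real (Suc m)^2)"
    using inverse_squares_sums by (auto simp: sums_iff add.commute)
  then show "summable (\<lambda>m. 1 / y^2 * (1 / real (Suc m)^2))" by (rule summable_mult)
  show "norm (1 / (c\<^sup>2 + (real (Suc m) * y)\<^sup>2)) \<le> 1 / y^2 * (1 / real (Suc m)^2)" for m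
  proof -
    have "0 < (real (Suc m) * y)\<^sup>2" "0 \<le> c\<^sup>2" using assms by (simp_all del: of_nat_Suc)
    then have "1 / (c\<^sup>2 + (real (Suc m) * y)\<^sup>2) \<le> 1 / (real (Suc m) * y)\<^sup>2"
      by (intro divide_left_mono mult_pos_pos) linarith+
    then show ?thesis by (simp add: power_mult_distrib mult.commute del: of_nat_Suc)
  qed
qed

text \<open>With step y / N, the numbers y N / (N^2 + (m y)^2) are the terms of a right Riemann sum
  of 1 / (1 + x^2) over the positive half-line. Monotonicity traps the sum between pi / 2 and pi / 2
  minus the first increment of arctan, which vanishes as N grows.\<close>

lemma lattice_row_limit:
  assumes "y > 0"
  shows "(\<lambda>N. real N * (\<Sum>m. 1 / ((real N)\<^sup>2 + (real (Suc m) * y)\<^sup>2))) \<longlonglongrightarrow> pi / (2 * y)"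
proof -
  have b: "(pi / 2 - arctan (y / real N)) / y \<le> real N * (\<Sum>m. 1 / ((real N)\<^sup>2 + (real (Suc m) * y)\<^sup>2)) \<and>
        real N * (\<Sum>m. 1 / ((real N)\<^sup>2 + (real (Suc m) * y)\<^sup>2)) \<le> pi / 2 / y" if N: "N > 0" for N
  proof -
    define A where "A m = arctan (real m * y / real N)" for m
    have mvt: "\<exists>\<xi>. real m * y / real N < \<xi> \<and> \<xi> < real (Suc m) * y / real N \<and>
       A (Suc m) - A m = (real (Suc m) * y / real N - real m * y / real N) * (inverse (1 + \<xi>^2))" for m
      unfolding A_def using assms N
      by (intro MVT2) (auto intro!: derivative_eq_intros simp: divide_strict_right_mono)
    have up: "y * (real N / ((real N)\<^sup>2 + (real (Suc m) * y)\<^sup>2)) \<le> A (Suc m) - A m"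
      and lo: "A (Suc (Suc m)) - A (Suc m) \<le> y * (real N / ((real N)\<^sup>2 + (real (Suc m) * y)\<^sup>2))" for m
    proof -
      have e: "y * (real N / ((real N)\<^sup>2 + (real k * y)\<^sup>2)) = y / real N * inverse (1 + (real k * y / real N)^2)" for k
        using N by (simp add: divide_simps power2_eq_square)
      have w: "real (Suc k) * y / real N - real k * y / real N = y / real N" for k
        by (simp add: diff_divide_distrib[symmetric] algebra_simps)
      obtain \<xi> where x: "real m * y / real N < \<xi>" "\<xi> < real (Suc m) * y / real N"
        "A (Suc m) - A m = y / real N * (inverse (1 + \<xi>^2))" using mvt[of m] unfolding w by blast
      have "0 \<le> real m * y / real N" using assms by simp
      then have "\<xi>^2 \<le> (real (Suc m) * y / real N)^2" using x by (intro power_mono) linarith+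
      then show "y * (real N / ((real N)\<^sup>2 + (real (Suc m) * y)\<^sup>2)) \<le> A (Suc m) - A m"
        unfolding e x(3) using assms by (intro mult_left_mono le_imp_inverse_le) (auto intro: add_pos_nonneg)
      obtain \<zeta> where x: "real (Suc m) * y / real N < \<zeta>"
        "A (Suc (Suc m)) - A (Suc m) = y / real N * (inverse (1 + \<zeta>^2))" using mvt[of "Suc m"] unfolding w by blast
      have "0 \<le> real (Suc m) * y / real N" using assms by simp
      then have "\<zeta>^2 \<ge> (real (Suc m) * y / real N)^2" using x by (intro power_mono) linarith+
      then show "A (Suc (Suc m)) - A (Suc m) \<le> y * (real N / ((real N)\<^sup>2 + (real (Suc m) * y)\<^sup>2))"
        unfolding e x(2) using assms by (intro mult_left_mono le_imp_inverse_le) (auto intro: add_pos_nonneg)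
    qed
    have l: "A \<longlonglongrightarrow> pi / 2"
      unfolding A_def using assms N by real_asymp
    have s: "(\<lambda>m. y * (real N / ((real N)\<^sup>2 + (real (Suc m) * y)\<^sup>2))) sums
        (y * (real N * (\<Sum>m. 1 / ((real N)\<^sup>2 + (real (Suc m) * y)\<^sup>2))))"
      using sums_mult[OF summable_sums[OF lattice_row_summable[OF assms, of "real N"]], of "y * real N"]
      by (simp add: mult_ac)
    have "y * (real N * (\<Sum>m. 1 / ((real N)\<^sup>2 + (real (Suc m) * y)\<^sup>2))) \<le> pi / 2 - A 0"
      by (rule sums_le[OF up s telescope_sums[OF l]])
    moreover have "pi / 2 - A 1 \<le> y * (real N * (\<Sum>m. 1 / ((real N)\<^sup>2 + (real (Suc m) * y)\<^sup>2)))"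
      using sums_le[OF lo telescope_sums[OF LIMSEQ_Suc[OF l]] s] by simp
    ultimately show ?thesis using assms by (simp add: A_def field_simps)
  qed
  show ?thesis
  proof (rule tendsto_sandwich)
    show "(\<lambda>N. (pi / 2 - arctan (y / real N)) / y) \<longlonglongrightarrow> pi / (2 * y)"
      using tendsto_divide[OF tendsto_diff[OF tendsto_const tendsto_arctan[OF lim_const_over_n[of y]]] tendsto_const,
          of y "pi / 2"] assms by simp
    show "(\<lambda>N. pi / 2 / y) \<longlonglongrightarrow> pi / (2 * y)" by simp
    show "\<forall>\<^sub>F N in sequentially. (pi / 2 - arctan (y / real N)) / y \<le> real N * (\<Sum>m. 1 / ((real N)\<^sup>2 + (real (Suc m) * y)\<^sup>2))"
      "\<forall>\<^sub>F N in sequentially. real N * (\<Sum>m. 1 / ((real N)\<^sup>2 + (real (Suc m) * y)\<^sup>2)) \<le> pi / 2 / y"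
      using b by (auto intro!: eventually_mono[OF eventually_gt_at_top[of "0::nat"]])
  qed
qed

lemma summable_lattice_kernel_sum:
  assumes "y > 0"
  shows "summable (\<lambda>m. lattice_kernel_sum (real (Suc m) * y))"
proof (rule summable_comparison_test')
  show "summable (\<lambda>m. 3 * (1 / (0\<^sup>2 + (real (Suc m) * y)\<^sup>2)))"
    by (intro summable_mult lattice_row_summable assms)
  \<comment> \<open>The tail estimate at N = 0, where the partial sum and the main term are both
    0.\<close>
  show "norm (lattice_kernel_sum (real (Suc m) * y)) \<le> 3 * (1 / (0\<^sup>2 + (real (Suc m) * y)\<^sup>2))" for m
    using lattice_kernel_tail[of "real (Suc m) * y" 0] assms by simp
qed

text \<open>Since \<open>lattice_kernel (m y) n = - lattice_kernel (n / y) m / y\<^sup>2\<close>, the left-hand side is the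
  difference between the two orders of summation of \<open>lattice_kernel (m y) n\<close>.\<close>

theorem lattice_kernel_sum_reciprocity:
  assumes y: "y > 0"
  shows "(\<Sum>m. lattice_kernel_sum (real (Suc m) * y)) + (\<Sum>m. lattice_kernel_sum (real (Suc m) * (1 / y))) / y\<^sup>2
           = pi / (2 * y)"
proof -
  define R where "R y = (\<Sum>m. lattice_kernel_sum (real (Suc m) * y))" for y
  define W where "W N = (\<Sum>m. 1 / ((real N)\<^sup>2 + (real (Suc m) * y)\<^sup>2))" for N
  \<comment> \<open>\<open>Q N\<close> is the sum over all rows with the first N columns removed: by
    the antisymmetry of the kernel, column n sums to
    \<open>- lattice_kernel_sum (n / y) / y^2\<close>.\<close>
  define Q where "Q N = R y + (\<Sum>n<N. lattice_kernel_sum (real (Suc n) * (1 / y))) / y\<^sup>2" for N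
  have col: "(\<lambda>m. lattice_kernel (real (Suc m) * y) (real (Suc n))) sums (- lattice_kernel_sum (real (Suc n) * (1 / y)) / y\<^sup>2)" for n
  proof -
    have "lattice_kernel (real (Suc m) * y) (real (Suc n)) = - (1 / y^2) * lattice_kernel (real (Suc n) * (1 / y)) (real (Suc m))" for m
    proof -
      define a b where "a = real (Suc m)" and "b = real (Suc n)"
      have "a^2 * y^2 + b^2 > 0" using y by (auto simp: a_def b_def intro!: add_nonneg_pos)
      then show ?thesis unfolding lattice_kernel_def a_def[symmetric] b_def[symmetric] using y
        by (simp add: divide_simps power_mult_distrib)
    qed
    then show ?thesis
      using sums_mult[OF lattice_kernel_sums[of "real (Suc n) * (1 / y)"], of "- (1/y^2)"] y by simp
  qed
  \<comment> \<open>The tail estimate is summed over the rows: \<open>Q N\<close> agrees with N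
    times \<open>W N\<close>, whose limit is pi / (2 y), up to 3 times \<open>W N\<close>, which
    tends to 0.\<close>
  have bd: "\<bar>Q N - real N * W N\<bar> \<le> 3 * W N" for N
  proof -
    have sW: "(\<lambda>m. 1 / ((real N)\<^sup>2 + (real (Suc m) * y)\<^sup>2)) sums W N"
      unfolding W_def by (intro summable_sums lattice_row_summable y)
    have sQ: "(\<lambda>m. lattice_kernel_sum (real (Suc m) * y) - (\<Sum>n<N. lattice_kernel (real (Suc m) * y) (real (Suc n)))) sums Q N"
    proof -
      have "(\<lambda>m. lattice_kernel_sum (real (Suc m) * y) - (\<Sum>n<N. lattice_kernel (real (Suc m) * y) (real (Suc n)))) sums
         (R y - (\<Sum>n<N. - lattice_kernel_sum (real (Suc n) * (1 / y)) / y\<^sup>2))"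
        unfolding R_def by (intro sums_diff sums_sum summable_sums summable_lattice_kernel_sum y col)
      then show ?thesis by (simp add: Q_def sum_negf sum_divide_distrib)
    qed
    note d = sums_diff[OF sQ sums_mult[OF sW, of "real N"]]
    have b: "\<bar>lattice_kernel_sum (real (Suc m) * y) - (\<Sum>n<N. lattice_kernel (real (Suc m) * y) (real (Suc n)))
        - real N * (1 / ((real N)\<^sup>2 + (real (Suc m) * y)\<^sup>2))\<bar>
        \<le> 3 * (1 / ((real N)\<^sup>2 + (real (Suc m) * y)\<^sup>2))" for m
      using lattice_kernel_tail[of "real (Suc m) * y" N] y by simp
    have "Q N - real N * W N \<le> 3 * W N"
      by (rule sums_le[OF _ d sums_mult[OF sW]]) (rule abs_le_D1[OF b])
    moreover have "-(Q N - real N * W N) \<le> 3 * W N"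
      by (rule sums_le[OF _ sums_minus[OF d] sums_mult[OF sW]]) (rule abs_le_D2[OF b])
    ultimately show ?thesis by simp
  qed
  have NW: "(\<lambda>N. real N * W N) \<longlonglongrightarrow> pi / (2 * y)"
    unfolding W_def by (rule lattice_row_limit[OF y])
  have "(\<lambda>N. (1 / real N) * (real N * W N)) \<longlonglongrightarrow> 0"
    using tendsto_mult[OF lim_1_over_n NW] by simp
  moreover have "\<forall>\<^sub>F N in sequentially. (1 / real N) * (real N * W N) = W N"
    using eventually_gt_at_top[of "0::nat"] by eventually_elim simp
  ultimately have W0: "W \<longlonglongrightarrow> 0"
    by (rule Lim_transform_eventually)
  have "(\<lambda>N. Q N - real N * W N) \<longlonglongrightarrow> 0"
    by (rule Lim_null_comparison[of _ "\<lambda>N. 3 * W N"])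
       (use bd tendsto_mult[OF tendsto_const W0, of 3] in auto)
  from tendsto_add[OF this NW] have "Q \<longlonglongrightarrow> pi / (2 * y)" by simp
  moreover have "Q \<longlonglongrightarrow> R y + R (1 / y) / y^2"
    unfolding Q_def R_def using y
    by (intro tendsto_intros summable_LIMSEQ summable_lattice_kernel_sum) auto
  ultimately have "R y + R (1 / y) / y^2 = pi / (2 * y)" by (rule LIMSEQ_unique[rotated])
  then show ?thesis by (simp only: R_def)
qed

section \<open>Inversion formula for the logarithm of the eta function\<close>

lemma summable_quadratic_power:
  fixes r :: real
  assumes "0 \<le> r" "r < 1"
  shows "summable (\<lambda>n. real n ^ 2 * r ^ n)"
proof -
  have "conv_radius (\<lambda>n. real n ^ 2) = ereal 1"
    by (rule conv_radius_ratio_limit_nonzero[of _ 1]) (simp_all, real_asymp)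
  then show ?thesis
    using assms summable_in_conv_radius[of r "\<lambda>n. real n ^ 2"] by simp
qed

lemma fps_conv_radius_ge_1_quadratic:
  fixes a :: "nat \<Rightarrow> complex"
  assumes "\<And>n. n > 0 \<Longrightarrow> norm (a n) \<le> C * real n ^ 2"
  shows "fps_conv_radius (Abs_fps a) \<ge> 1"
  unfolding fps_conv_radius_def
proof (rule conv_radius_geI_ex')
  fix r :: real assume r: "0 < r" "ereal r < 1"
  have "summable (\<lambda>n. a (Suc n) * of_real r ^ Suc n)"
  proof (rule summable_comparison_test')
    have "summable (\<lambda>n. C * (real n ^ 2 * r ^ n))"
      using r by (intro summable_mult summable_quadratic_power) auto
    then show "summable (\<lambda>n. C * (real (Suc n) ^ 2 * r ^ Suc n))" by (subst summable_Suc_iff)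
    show "norm (a (Suc n) * of_real r ^ Suc n) \<le> C * (real (Suc n) ^ 2 * r ^ Suc n)" for n
      using mult_right_mono[OF assms[of "Suc n"], of "r ^ Suc n"] r
      by (simp add: norm_mult norm_power mult.assoc del: power_Suc)
  qed
  then show "summable (\<lambda>n. fps_nth (Abs_fps a) n * of_real r ^ n)"
    by (subst (asm) summable_Suc_iff) simp
qed

definition divisor_sum :: "nat \<Rightarrow> nat" where
  "divisor_sum n = \<Sum>{d. d dvd n}"

text \<open>Every natural number divides 0, and a sum over an infinite set is 0 by convention. The
  series of divisor sums therefore have constant term 0.\<close>

lemma divisor_sum_0 [simp]: "divisor_sum 0 = 0"
  by (simp add: divisor_sum_def)

lemma divisor_sum_le: "divisor_sum n \<le> n ^ 2"
proof (cases "n = 0")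
  case False
  then have "{d. d dvd n} \<subseteq> {1..n}" by (auto intro: dvd_imp_le Nat.gr0I simp: Suc_le_eq)
  then have "divisor_sum n \<le> \<Sum>{1..n}"
    unfolding divisor_sum_def by (intro sum_mono2) auto
  also have "\<dots> \<le> (\<Sum>d\<in>{1..n}. n)" by (intro sum_mono) auto
  finally show ?thesis by (simp add: power2_eq_square)
qed auto

definition divisor_fps :: "complex fps" where
  "divisor_fps = Abs_fps (\<lambda>n. of_nat (divisor_sum n))"

text \<open>The expansion of \<open>- \<Sum>m\<ge>1. ln (1 - q\<^sup>m)\<close>.\<close>

definition log_euler_fps :: "complex fps" where
  "log_euler_fps = Abs_fps (\<lambda>n. of_nat (divisor_sum n) / of_nat n)"

lemma fps_conv_radius_divisor_fps: "fps_conv_radius divisor_fps \<ge> 1"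
  unfolding divisor_fps_def
  by (rule fps_conv_radius_ge_1_quadratic[of _ 1])
     (use divisor_sum_le in \<open>simp add: of_nat_mono flip: of_nat_power\<close>)

lemma fps_conv_radius_log_euler_fps: "fps_conv_radius log_euler_fps \<ge> 1"
  unfolding log_euler_fps_def
proof (rule fps_conv_radius_ge_1_quadratic[of _ 1])
  fix n :: nat assume "n > 0"
  then have "real (divisor_sum n) / real n \<le> real (divisor_sum n)"
    by (simp add: divide_le_eq mult_le_cancel_left1)
  also have "\<dots> \<le> real (n ^ 2)" using divisor_sum_le by (simp only: of_nat_le_iff)
  finally show "norm (of_nat (divisor_sum n) / of_nat n :: complex) \<le> 1 * (real n)\<^sup>2"
    by (simp add: norm_divide)
qed

lemma log_euler_fps_deriv: "fps_X * fps_deriv log_euler_fps = divisor_fps"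
proof (rule fps_ext)
  fix n show "fps_nth (fps_X * fps_deriv log_euler_fps) n = fps_nth divisor_fps n"
    by (cases n) (auto simp: log_euler_fps_def divisor_fps_def simp del: of_nat_Suc)
qed

lemma eval_divisor_fps_sums:
  assumes "norm w < 1"
  shows "(\<lambda>n. of_nat (divisor_sum n) * w ^ n) sums eval_fps divisor_fps w"
  using sums_eval_fps[of w divisor_fps] order.strict_trans2[OF _ fps_conv_radius_divisor_fps, of "norm w"] assms
  by (simp add: divisor_fps_def)

text \<open>Write n = m d and sum over d first, for fixed m: the sum of d x^(m d) is x^m / (1 -
  x^m)^2. All terms are nonnegative, which justifies the rearrangement.\<close>

lemma divisor_sum_lambert:
  assumes x: "0 < x" "x < (1::real)" and S: "(\<lambda>n. real (divisor_sum n) * x ^ n) sums S"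
  shows "(\<lambda>m. x ^ Suc m / (1 - x ^ Suc m) ^ 2) sums S"
proof -
  define f where "f = (\<lambda>(n::nat, d::nat). real d * x ^ n)"
  have N: "((\<lambda>n. real (divisor_sum n) * x ^ n) has_sum S) {1..}"
  proof -
    have "((\<lambda>n. real (divisor_sum n) * x ^ n) has_sum S) UNIV"
      using S x by (intro sums_nonneg_imp_has_sum) auto
    then show ?thesis
      by (subst has_sum_cong_neutral[where T = UNIV and g = "\<lambda>n. real (divisor_sum n) * x ^ n"])
         (auto simp: not_le)
  qed
  have inner: "((\<lambda>d. f (n, d)) has_sum real (divisor_sum n) * x ^ n) {d. d dvd n}" if "n \<in> {1..}" for n
    using that by (intro has_sum_finiteI) (auto simp: f_def divisor_sum_def sum_distrib_right)
  have "(f has_sum S) (Sigma {1..} (\<lambda>n. {d. d dvd n}))"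
    using x by (intro has_sum_SigmaI[OF inner N] summable_on_SigmaI[OF inner has_sum_imp_summable[OF N]])
       (auto simp: f_def)
  also have "(f has_sum S) (Sigma {1..} (\<lambda>n. {d. d dvd n})) \<longleftrightarrow>
      ((\<lambda>(m, k). real k * x ^ (m * k)) has_sum S) ({1..} \<times> {1..})"
    by (rule has_sum_reindex_bij_witness[of _ "\<lambda>(m, k). (m * k, k)" "\<lambda>(n, d). (n div d, d)"])
       (auto simp: f_def mult.commute elim!: dvdE)
  finally have "((\<lambda>(m, k). real k * x ^ (m * k)) has_sum S) ({1..} \<times> {1..})" .
  moreover have "((\<lambda>k. (case (m, k) of (m, k) \<Rightarrow> real k * x ^ (m * k))) has_sum x ^ m / (1 - x ^ m) ^ 2) {1..}"
    if m: "m \<in> {1..}" for m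
  proof -
    define r where "r = x ^ m"
    have r: "0 < r" "r < 1" using x m power_strict_decreasing[of 0 m x] by (auto simp: r_def)
    have "(\<lambda>k. r * (real (Suc k) * r ^ k)) sums (r * (1 / (1 - r)^2))"
      using geometric_deriv_sums[of r] r by (intro sums_mult) auto
    then have "((\<lambda>k. r * (real (Suc k) * r ^ k)) has_sum (r / (1 - r)^2)) UNIV"
      using r by (intro sums_nonneg_imp_has_sum) auto
    also have "?this \<longleftrightarrow> ((\<lambda>k. real k * x ^ (m * k)) has_sum (r / (1 - r)^2)) {1..}"
      by (rule has_sum_reindex_bij_witness[of _ "\<lambda>k. k - 1" Suc]) (auto simp: r_def power_add power_mult algebra_simps simp flip: power_mult)
    finally show ?thesis by (simp add: r_def)
  qed
  ultimately have "((\<lambda>m. x ^ m / (1 - x ^ m) ^ 2) has_sum S) {1..}"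
    by (rule has_sum_SigmaD)
  also have "?this \<longleftrightarrow> ((\<lambda>m. x ^ Suc m / (1 - x ^ Suc m) ^ 2) has_sum S) UNIV"
    by (rule has_sum_reindex_bij_witness[of _ Suc "\<lambda>m. m - 1"]) auto
  finally show ?thesis by (rule has_sum_imp_sums)
qed

lemma sinh_squared_reciprocal:
  fixes u :: real
  assumes "u > 0"
  shows "exp (- 2 * u) / (1 - exp (- 2 * u))\<^sup>2 = 1 / (4 * (sinh u)\<^sup>2)"
proof -
  define e where "e = exp u"
  have e: "e > 1" using assms by (simp add: e_def)
  have "exp (- 2 * u) = 1 / e^2"
    using exp_double[of "- u"] by (simp add: e_def exp_minus inverse_eq_divide power_divide)
  moreover have "sinh u = (e - 1 / e) / 2"
    by (simp add: sinh_def e_def exp_minus inverse_eq_divide)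
  moreover have "1 - 1 / e^2 = (e - 1 / e) / e"
    using e by (simp add: diff_divide_distrib power2_eq_square)
  moreover define d where "d = e - 1 / e"
  ultimately have "exp (- 2 * u) = 1 / e\<^sup>2" "sinh u = d / 2" "1 - exp (- 2 * u) = d / e"
    by simp_all
  then show ?thesis using e by (simp only: power_divide) simp
qed

text \<open>Here 1 - 24 P and 1 - 24 Q are the values of the holomorphic E_2 at i y and i / y, so
  this is E_2(-1/z) = z^2 E_2(z) + 6 z / (pi i) at z = i y. The right-hand side is the discrepancy
  between the two orders of summation.\<close>

lemma divisor_series_reciprocity:
  assumes y: "y > 0"
    and P: "(\<lambda>n. real (divisor_sum n) * exp (- 2 * pi * y) ^ n) sums P"
    and Q: "(\<lambda>n. real (divisor_sum n) * exp (- 2 * pi * (1 / y)) ^ n) sums Q"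
  shows "(1 - 24 * P) + (1 - 24 * Q) / y\<^sup>2 = 6 / (pi * y)"
proof -
  \<comment> \<open>The part 1 / u^2 of \<open>lattice_kernel_sum\<close> contributes zeta(2), and
    the part with sinh is the Lambert series at exp (- 2 pi v).\<close>
  have R: "(\<Sum>m. lattice_kernel_sum (real (Suc m) * v)) = pi\<^sup>2 / (12 * v\<^sup>2) - 2 * pi\<^sup>2 * T"
    if v: "v > 0" and T: "(\<lambda>n. real (divisor_sum n) * exp (- 2 * pi * v) ^ n) sums T" for v T
  proof -
    have "(\<lambda>m. exp (- 2 * pi * v) ^ Suc m / (1 - exp (- 2 * pi * v) ^ Suc m) ^ 2) sums T"
      using v by (intro divisor_sum_lambert T) auto
    also have "(\<lambda>m. exp (- 2 * pi * v) ^ Suc m / (1 - exp (- 2 * pi * v) ^ Suc m) ^ 2) =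
       (\<lambda>m. 1 / (4 * (sinh (pi * (real (Suc m) * v)))\<^sup>2))"
    proof
      fix m
      have "exp (- 2 * pi * v) ^ Suc m = exp (- 2 * (pi * (real (Suc m) * v)))"
        by (subst exp_of_nat_mult[symmetric]) (simp add: algebra_simps)
      then show "exp (- 2 * pi * v) ^ Suc m / (1 - exp (- 2 * pi * v) ^ Suc m) ^ 2 =
          1 / (4 * (sinh (pi * (real (Suc m) * v)))\<^sup>2)"
        using sinh_squared_reciprocal[of "pi * (real (Suc m) * v)"] v by simp
    qed
    finally have 1: "(\<lambda>m. 1 / (4 * (sinh (pi * (real (Suc m) * v)))\<^sup>2)) sums T" .
    have 2: "(\<lambda>m. 1 / (real (Suc m))\<^sup>2) sums (pi\<^sup>2 / 6)"
      using inverse_squares_sums by (simp add: add.commute)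
    have "(\<lambda>m. 1 / (2 * v\<^sup>2) * (1 / (real (Suc m))\<^sup>2) - 2 * pi\<^sup>2 * (1 / (4 * (sinh (pi * (real (Suc m) * v)))\<^sup>2)))
        sums (1 / (2 * v\<^sup>2) * (pi\<^sup>2 / 6) - 2 * pi\<^sup>2 * T)"
      by (intro sums_diff sums_mult 1 2)
    also have "(\<lambda>m. 1 / (2 * v\<^sup>2) * (1 / (real (Suc m))\<^sup>2) - 2 * pi\<^sup>2 * (1 / (4 * (sinh (pi * (real (Suc m) * v)))\<^sup>2))) =
       (\<lambda>m. lattice_kernel_sum (real (Suc m) * v))"
      unfolding lattice_kernel_sum_def
      by (simp add: power_mult_distrib power_divide diff_divide_distrib mult_ac del: of_nat_Suc)
    finally show ?thesis by (simp add: sums_iff)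
  qed
  have "pi\<^sup>2 / (12 * y\<^sup>2) - 2 * pi\<^sup>2 * P + (pi\<^sup>2 / (12 * (1 / y)\<^sup>2) - 2 * pi\<^sup>2 * Q) / y\<^sup>2 = pi / (2 * y)"
    using lattice_kernel_sum_reciprocity[OF y] R[OF y P] R[OF _ Q] y by simp
  moreover have "pi\<^sup>2 / (12 * y\<^sup>2) - 2 * pi\<^sup>2 * P + (pi\<^sup>2 / (12 * (1 / y)\<^sup>2) - 2 * pi\<^sup>2 * Q) / y\<^sup>2 =
      pi\<^sup>2 / 12 * ((1 - 24 * P) + (1 - 24 * Q) / y\<^sup>2)"
    using y by (simp add: field_simps)
  moreover have "pi / (2 * y) = pi\<^sup>2 / 12 * (6 / (pi * y))"
    by (simp add: power2_eq_square)
  ultimately have "pi\<^sup>2 / 12 * ((1 - 24 * P) + (1 - 24 * Q) / y\<^sup>2) = pi\<^sup>2 / 12 * (6 / (pi * y))"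
    by (simp only:)
  then show ?thesis by (rule mult_left_cancel[THEN iffD1, rotated]) simp
qed

section \<open>The logarithm of eta and its inversion\<close>

lemma open_upper_half_plane: "open upper_half_plane"
  by (simp add: upper_half_plane_def open_halfspace_Im_gt)

lemma convex_upper_half_plane: "convex upper_half_plane"
  by (simp add: upper_half_plane_def convex_halfspace_Im_gt)

lemma norm_qexp: "norm (qexp z) = exp (- 2 * pi * Im z)"
  by (simp add: qexp_def norm_exp_eq_Re)

lemma norm_qexp_less_1: "z \<in> upper_half_plane \<Longrightarrow> norm (qexp z) < 1"
  by (simp add: norm_qexp upper_half_plane_def)

lemma qexp_nonzero [simp]: "qexp z \<noteq> 0"
  by (simp add: qexp_def)

lemma qexp_has_field_derivative [derivative_intros]:
  "(f has_field_derivative f') (at z within A) \<Longrightarrow>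
   ((\<lambda>z. qexp (f z)) has_field_derivative (2 * of_real pi * \<i> * qexp (f z) * f')) (at z within A)"
  unfolding qexp_def by (auto intro!: derivative_eq_intros)

text \<open>The logarithm of the fourth power of the Dedekind eta function, and its derivative.\<close>

definition log_eta4 :: "complex \<Rightarrow> complex" where
  "log_eta4 z = of_real pi * \<i> / 3 * z - 4 * eval_fps log_euler_fps (qexp z)"

definition log_eta4' :: "complex \<Rightarrow> complex" where
  "log_eta4' z = of_real pi * \<i> / 3 * (1 - 24 * eval_fps divisor_fps (qexp z))"

lemma log_eta4_has_field_derivative:
  assumes "z \<in> upper_half_plane"
  shows "(log_eta4 has_field_derivative log_eta4' z) (at z within A)"
proof -
  have q: "ereal (norm (qexp z)) < fps_conv_radius log_euler_fps"
    using norm_qexp_less_1[OF assms] fps_conv_radius_log_euler_fps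
    by (meson ereal_less(3) order.strict_trans2)
  have "eval_fps divisor_fps (qexp z) = qexp z * eval_fps (fps_deriv log_euler_fps) (qexp z)"
    unfolding log_euler_fps_deriv[symmetric]
    using q fps_conv_radius_deriv[of log_euler_fps] by (subst eval_fps_mult) auto
  then have e: "of_real pi * \<i> / 3 * 1 - 4 * (eval_fps (fps_deriv log_euler_fps) (qexp z) * (2 * of_real pi * \<i> * qexp z * 1))
      = log_eta4' z"
    unfolding log_eta4'_def by (simp add: algebra_simps)
  have "((\<lambda>z. eval_fps log_euler_fps (qexp z)) has_field_derivative
      (eval_fps (fps_deriv log_euler_fps) (qexp z) * (2 * of_real pi * \<i> * qexp z * 1))) (at z within A)"
    by (rule DERIV_chain2[of "eval_fps log_euler_fps"] has_field_derivative_eval_fps q derivative_intros)+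
  then show ?thesis
    unfolding log_eta4_def[abs_def] e[symmetric]
    by (intro DERIV_diff DERIV_cmult DERIV_ident)
qed

lemma log_eta4'_holomorphic: "log_eta4' holomorphic_on upper_half_plane"
proof -
  have "deriv log_eta4 holomorphic_on upper_half_plane"
    using log_eta4_has_field_derivative
    by (intro holomorphic_deriv open_upper_half_plane)
       (auto simp: holomorphic_on_def field_differentiable_def)
  then show ?thesis
    by (rule holomorphic_transform) (use log_eta4_has_field_derivative in \<open>auto intro: DERIV_imp_deriv\<close>)
qed

lemma upper_half_plane_inversion: "z \<in> upper_half_plane \<Longrightarrow> - 1 / z \<in> upper_half_plane"
  by (auto simp: upper_half_plane_def Im_divide sum_power2_gt_zero_iff intro!: divide_pos_pos)

text \<open>On the imaginary axis \<open>qexp\<close> is real, so the values of the divisor series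
  are real and the real reciprocity applies to them.\<close>

lemma log_eta4'_imaginary_axis:
  assumes y: "y > 0"
  shows "log_eta4' (- 1 / (\<i> * of_real y)) / (\<i> * of_real y)\<^sup>2 - log_eta4' (\<i> * of_real y)
           = 2 / (\<i> * of_real y)"
proof -
  have q: "qexp (\<i> * of_real v) = of_real (exp (- 2 * pi * v))" for v
    by (simp add: qexp_def exp_of_real[symmetric] algebra_simps)
  have ex: "\<exists>S. (\<lambda>n. real (divisor_sum n) * exp (- 2 * pi * v) ^ n) sums S \<and>
     log_eta4' (\<i> * of_real v) = of_real pi * \<i> / 3 * of_real (1 - 24 * S)" if v: "v > 0" for v
  proof -
    have s: "(\<lambda>n. of_real (real (divisor_sum n) * exp (- 2 * pi * v) ^ n)) sums
        eval_fps divisor_fps (qexp (\<i> * of_real v))"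
      using eval_divisor_fps_sums[OF norm_qexp_less_1[of "\<i> * of_real v"]] v
      by (simp add: upper_half_plane_def q)
    then have "(\<lambda>n. real (divisor_sum n) * exp (- 2 * pi * v) ^ n) sums
        Re (eval_fps divisor_fps (qexp (\<i> * of_real v)))"
      using sums_Re[OF s] by (simp add: Re_complex_of_real)
    moreover from this have "(\<lambda>n. complex_of_real (real (divisor_sum n) * exp (- 2 * pi * v) ^ n)) sums
        of_real (Re (eval_fps divisor_fps (qexp (\<i> * of_real v))))"
      by (rule sums_of_real)
    with s have "eval_fps divisor_fps (qexp (\<i> * of_real v)) =
        of_real (Re (eval_fps divisor_fps (qexp (\<i> * of_real v))))"
      by (rule sums_unique2)
    ultimately show ?thesis
      unfolding log_eta4'_def
      by (intro exI[of _ "Re (eval_fps divisor_fps (qexp (\<i> * of_real v)))"]) simp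
  qed
  obtain P where P: "(\<lambda>n. real (divisor_sum n) * exp (- 2 * pi * y) ^ n) sums P"
    "log_eta4' (\<i> * of_real y) = of_real pi * \<i> / 3 * of_real (1 - 24 * P)" using ex[OF y] by blast
  obtain Q where Q: "(\<lambda>n. real (divisor_sum n) * exp (- 2 * pi * (1 / y)) ^ n) sums Q"
    "log_eta4' (\<i> * of_real (1 / y)) = of_real pi * \<i> / 3 * of_real (1 - 24 * Q)"
    using ex[of "1 / y"] y by auto
  have i: "- 1 / (\<i> * of_real y) = \<i> * of_real (1 / y)"
    using y by (simp add: field_simps)
  have "log_eta4' (- 1 / (\<i> * of_real y)) / (\<i> * of_real y)\<^sup>2 - log_eta4' (\<i> * of_real y) =
     - (of_real pi * \<i> / 3 * of_real ((1 - 24 * P) + (1 - 24 * Q) / y\<^sup>2))"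
    unfolding i P(2) Q(2) by (simp add: power_mult_distrib algebra_simps)
  also have "\<dots> = 2 / (\<i> * of_real y)"
    unfolding divisor_series_reciprocity[OF y P(1) Q(1)] using y by (simp add: field_simps)
  finally show ?thesis .
qed

text \<open>The divisor series controls only the derivative of \<open>log_eta4\<close>, so the
  identity theorem is applied to the derivative \<open>D'\<close> of the difference. For z in the
  upper half-plane, -i z has positive real part, which keeps the principal \<open>Ln\<close>
  holomorphic.\<close>

theorem log_eta4_inversion:
  assumes z: "z \<in> upper_half_plane"
  shows "log_eta4 (- 1 / z) = log_eta4 z + 2 * Ln (- \<i> * z)"
proof -
  define D where "D z = log_eta4 (- 1 / z) - log_eta4 z - 2 * Ln (- \<i> * z)" for z
  define D' where "D' z = log_eta4' (- 1 / z) / z\<^sup>2 - log_eta4' z - 2 / z" for z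
  have D: "(D has_field_derivative D' w) (at w)" if "w \<in> upper_half_plane" for w
  proof -
    have w: "w \<noteq> 0" "- \<i> * w \<notin> \<real>\<^sub>\<le>\<^sub>0"
      using that by (auto simp: upper_half_plane_def complex_nonpos_Reals_iff)
    have "((\<lambda>z. - 1 / z) has_field_derivative (1 / w\<^sup>2)) (at w)"
      using w by (auto intro!: derivative_eq_intros simp: power2_eq_square)
    from DERIV_chain2[OF log_eta4_has_field_derivative[OF upper_half_plane_inversion[OF that]] this]
    have "((\<lambda>z. log_eta4 (- 1 / z)) has_field_derivative (log_eta4' (- 1 / w) / w\<^sup>2)) (at w)" by simp
    moreover have "((\<lambda>z. 2 * Ln (- \<i> * z)) has_field_derivative (2 / w)) (at w)"
      using w by (auto intro!: derivative_eq_intros simp: field_simps)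
    ultimately show ?thesis
      unfolding D_def D'_def using log_eta4_has_field_derivative[OF that]
      by (intro DERIV_diff)
  qed
  have D'0: "D' w = 0" if "w \<in> upper_half_plane" for w
  proof (rule analytic_continuation[of D' upper_half_plane "(\<lambda>y. \<i> * of_real y) ` {0<..}" \<i>])
    show "D' holomorphic_on upper_half_plane"
    proof -
      have nz: "z \<noteq> 0" if "z \<in> upper_half_plane" for z
        using that by (auto simp: upper_half_plane_def)
      have "(\<lambda>z. - 1 / z) holomorphic_on upper_half_plane"
        using nz by (intro holomorphic_intros)
      then have "(\<lambda>z. log_eta4' (- 1 / z)) holomorphic_on upper_half_plane"
        using holomorphic_on_compose_gen[OF _ log_eta4'_holomorphic] upper_half_plane_inversion
        by (fastforce simp: o_def)
      then show ?thesis
        unfolding D'_def using nz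
        by (intro holomorphic_on_diff holomorphic_on_divide log_eta4'_holomorphic holomorphic_intros) auto
    qed
    show "open upper_half_plane" "connected upper_half_plane"
      by (simp_all add: open_upper_half_plane convex_connected convex_upper_half_plane)
    show "(\<lambda>y. \<i> * of_real y) ` {0<..} \<subseteq> upper_half_plane" "\<i> \<in> upper_half_plane"
      by (auto simp: upper_half_plane_def)
    show "\<i> islimpt (\<lambda>y. \<i> * of_real y) ` {0<..}"
      unfolding islimpt_approachable
    proof (intro allI impI)
      fix e :: real assume "e > 0"
      then show "\<exists>x'\<in>(\<lambda>y. \<i> * of_real y) ` {0<..}. x' \<noteq> \<i> \<and> dist x' \<i> < e"
        by (intro bexI[of _ "\<i> * of_real (1 + e / 2)"] imageI) (auto simp: dist_norm algebra_simps norm_mult)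
    qed
    show "D' z = 0" if "z \<in> (\<lambda>y. \<i> * of_real y) ` {0<..}" for z
      using that log_eta4'_imaginary_axis by (auto simp: D'_def)
  qed fact
  have "\<exists>c. \<forall>w\<in>upper_half_plane. D w = c"
    using D D'0 by (intro has_field_derivative_zero_constant convex_upper_half_plane)
      (auto intro: has_field_derivative_at_within)
  then obtain c where c: "\<And>w. w \<in> upper_half_plane \<Longrightarrow> D w = c" by blast
  \<comment> \<open>The constant is found at the fixed point i of z -> -1/z, where
    \<open>Ln (- \<i> * \<i>) = Ln 1 = 0\<close>.\<close>
  have "c = D \<i>" using c[of \<i>] by (simp add: upper_half_plane_def)
  also have "\<dots> = 0" by (simp add: D_def)
  finally show ?thesis using c[OF z] by (simp add: D_def algebra_simps)
qed

section \<open>Modular invariance\<close>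

text \<open>The function H of the overview. Passing to the real part removes the multiplier system
  of eta.\<close>

definition log_eta_norm :: "complex \<Rightarrow> real" where
  "log_eta_norm z = ln (Im z) + Re (log_eta4 z)"

lemma qexp_add: "qexp (z + w) = qexp z * qexp w"
  by (simp add: qexp_def distrib_left exp_add)

lemma qexp_of_int [simp]: "qexp (of_int n) = 1"
  using exp_integer_2pi[of "of_int n"] by (simp add: qexp_def mult_ac)

text \<open>Under z -> z + n, \<open>log_eta4\<close> changes by pi i n / 3, which has real part
  0.\<close>

lemma log_eta_norm_add_int: "log_eta_norm (z + of_int n) = log_eta_norm z"
  by (simp add: log_eta_norm_def log_eta4_def qexp_add algebra_simps)

text \<open>The term 2 \<open>Ln (- \<i> * z)\<close> of the inversion formula has real part 2 ln
  |z|, which offsets the factor |z|^-2 gained by \<open>Im z\<close>.\<close>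

lemma log_eta_norm_inversion:
  assumes "z \<in> upper_half_plane"
  shows "log_eta_norm (- 1 / z) = log_eta_norm z"
proof -
  have z: "z \<noteq> 0" "Im z > 0" using assms by (auto simp: upper_half_plane_def)
  have "Im (- 1 / z) = Im z / norm z ^ 2"
    by (simp add: Im_divide cmod_power2)
  then have "ln (Im (- 1 / z)) = ln (Im z) - 2 * ln (norm z)"
    using z by (simp add: ln_div ln_realpow)
  moreover have "Re (Ln (- \<i> * z)) = ln (norm z)"
    using z by (subst Re_Ln) (auto simp: norm_mult)
  ultimately show ?thesis
    unfolding log_eta_norm_def log_eta4_inversion[OF assms] by simp
qed

lemma mobius_denominator_nonzero:
  assumes "z \<in> upper_half_plane" "a * d - b * c = 1"
  shows "of_int c * z + of_int d \<noteq> 0"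
proof
  assume e: "of_int c * z + of_int d = 0"
  then have "of_int c * Im z = 0" by (metis Im_complex_of_real complex_Im_of_int Im_i_times add.right_neutral
      complex.sel(2) zero_complex.sel(2) plus_complex.sel(2) times_complex.sel(2) complex_Re_of_int mult_zero_left)
  then have "c = 0" using assms by (auto simp: upper_half_plane_def)
  with e assms show False by simp
qed

lemma Im_mobius:
  assumes "a * d - b * c = 1"
  shows "Im (mobius (a, b, c, d) z) = Im z / norm (of_int c * z + of_int d) ^ 2"
proof -
  have "real_of_int a * real_of_int d - real_of_int b * real_of_int c = 1"
    using assms by (metis of_int_1 of_int_diff of_int_mult)
  then have "real_of_int a * real_of_int d * Im z = (1 + real_of_int b * real_of_int c) * Im z"
    by (simp add: algebra_simps)
  then show ?thesis
    by (simp add: mobius_def Im_divide cmod_power2 algebra_simps)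
qed

lemma mobius_in_upper_half_plane:
  assumes "z \<in> upper_half_plane" "a * d - b * c = 1"
  shows "mobius (a, b, c, d) z \<in> upper_half_plane"
  using mobius_denominator_nonzero[OF assms] assms(1)
  by (simp add: upper_half_plane_def Im_mobius[OF assms(2)])

text \<open>Euclid's algorithm on the first column reduces a matrix to translations and inversions.\<close>

theorem log_eta_norm_mobius:
  assumes "a * d - b * c = 1" "z \<in> upper_half_plane"
  shows "log_eta_norm (mobius (a, b, c, d) z) = log_eta_norm z"
  using assms(1)
proof (induction "nat \<bar>c\<bar>" arbitrary: a b c d rule: less_induct)
  case (less c a b d)
  show ?case
  proof (cases "c = 0")
    case True
    then have "a * d = 1" using less.prems by simp
    then have "a = 1 \<and> d = 1 \<or> a = - 1 \<and> d = - 1" by (simp add: zmult_eq_1_iff)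
    then have "mobius (a, b, c, d) z = z + of_int (a * b)"
      using True by (auto simp: mobius_def minus_divide_left[symmetric])
    then show ?thesis by (simp only: log_eta_norm_add_int)
  next
    case False
    define q r where "q = a div c" and "r = a mod c"
    define b' where "b' = b - q * d"
    have a: "a = q * c + r" by (simp add: q_def r_def)
    \<comment> \<open>The matrix with rows (-c, -d) and (r, b') arises from the given one by the
      translation by -q followed by z -> -1/z. Its lower left entry r is smaller in absolute value
      than c.\<close>
    have det: "(- c) * b' - (- d) * r = 1"
      using less.prems by (simp add: a b'_def algebra_simps)
    have "\<bar>r\<bar> < \<bar>c\<bar>" using False by (simp add: r_def abs_mod_less)
    then have "log_eta_norm (mobius (- c, - d, r, b') z) = log_eta_norm z"
      by (intro less.hyps det) auto
    moreover have "mobius (a, b, c, d) z = - 1 / mobius (- c, - d, r, b') z + of_int q"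
    proof -
      define U V where "U = of_int c * z + of_int d" and "V = of_int r * z + of_int b'"
      have "U \<noteq> 0" "V \<noteq> 0"
        using mobius_denominator_nonzero[OF assms(2)] less.prems det unfolding U_def V_def by blast+
      moreover have "of_int a * z + of_int b = V + of_int q * U"
        by (simp add: U_def V_def a b'_def algebra_simps)
      moreover have "of_int (- c) * z + of_int (- d) = - U"
        by (simp add: U_def)
      moreover have "(V + of_int q * U) / U = - 1 / (- U / V) + of_int q"
        using calculation(1,2) by (simp add: add_divide_distrib)
      ultimately show ?thesis
        unfolding mobius_def prod.case by (simp only: flip: U_def V_def)
    qed
    moreover have "mobius (- c, - d, r, b') z \<in> upper_half_plane"
      by (rule mobius_in_upper_half_plane[OF assms(2) det])
    ultimately show ?thesis by (simp only: log_eta_norm_add_int log_eta_norm_inversion)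
  qed
qed

section \<open>Scaled arguments at an arbitrary cusp\<close>

text \<open>Hermite normal form: the matrix diag(m, 1) gamma has determinant m and is a product of a
  matrix in SL_2(Z) and an upper triangular one. The first column (m a, c), divided by its gcd,
  becomes the first column of the left factor, and Bezout coefficients complete that factor.\<close>

lemma scaled_mobius_decomposition:
  fixes m :: nat
  assumes m: "m > 0" and det: "a * d - b * c = 1"
  obtains A D :: nat and B a' b' c' d' :: int
  where "A * D = m" "a' * d' - b' * c' = 1"
    "\<And>z. z \<in> upper_half_plane \<Longrightarrow> of_nat m * mobius (a, b, c, d) z =
       mobius (a', b', c', d') ((of_nat A * z + of_int B) / of_nat D)"
proof -
  define g where "g = gcd (int m * a) c"
  have "g \<noteq> 0" using m det by (auto simp: g_def)
  then have g: "g > 0" using gcd_ge_0_int[of "int m * a" c] unfolding g_def by linarith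
  have "g dvd (int m * a) * d - (int m * b) * c" 
    by (intro dvd_diff dvd_mult2[of g "int m * a"] dvd_mult[of g c]) (simp_all add: g_def)
  also have "(int m * a) * d - (int m * b) * c = int m * (a * d - b * c)" by (simp add: algebra_simps)
  finally have "g dvd int m" using det by simp
  then obtain D where D: "int m = g * D" by (elim dvdE)
  have D0: "D > 0" using D m g by (metis of_nat_0_less_iff zero_less_mult_pos)
  obtain a' where a': "int m * a = g * a'" unfolding g_def by (meson dvdE gcd_dvd1)
  obtain c' where c': "c = g * c'" unfolding g_def by (meson dvdE gcd_dvd2)
  obtain x y where bez: "x * (int m * a) + y * c = g" unfolding g_def using bezout_int by blast
  have "g * (x * a' + y * c') = x * (g * a') + y * (g * c')" by (simp add: algebra_simps)
  also have "\<dots> = g * 1" using bez by (simp flip: a' c')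
  finally have xy: "x * a' + y * c' = 1" using g by simp
  \<comment> \<open>The upper right entry of the product of diag(m, 1) gamma with the inverse of the
    left factor, whose first row is (x, y).\<close>
  define B where "B = x * int m * b + y * d"
  have e1: "a' * B - y * D = int m * b"
  proof -
    have "g * (a' * B - y * D) = a' * g * B - y * int m" by (simp add: D algebra_simps)
    also have "\<dots> = int m * a * (x * int m * b + y * d) - y * int m" by (simp add: a' B_def mult.commute[of _ g])
    also have "\<dots> = int m * (b * (x * (int m * a)) + y * (a * d - 1))" by (simp add: algebra_simps)
    also have "a * d - 1 = b * c" using det by simp
    also have "b * (x * (int m * a)) + y * (b * c) = b * (x * (int m * a) + y * c)" by (simp add: algebra_simps)
    also have "x * (int m * a) + y * c = g" by (rule bez)
    finally show ?thesis using g by (simp add: mult.commute[of _ g])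
  qed
  have e2: "c' * B + x * D = d"
  proof -
    have "g * (c' * B + x * D) = c * B + x * int m" by (simp add: D c' algebra_simps)
    also have "\<dots> = c * (x * int m * b + y * d) + x * int m * (a * d - b * c)" by (simp add: B_def det)
    also have "\<dots> = d * (x * (int m * a) + y * c)" by (simp add: algebra_simps)
    also have "x * (int m * a) + y * c = g" by (rule bez)
    finally show ?thesis using g by (simp add: mult.commute[of _ g])
  qed
  show ?thesis
  proof (rule that[of "nat g" "nat D" a' x "- y" c' B])
    show "nat g * nat D = m" using D g D0 by (simp add: nat_mult_distrib[symmetric])
    show "a' * x - - y * c' = 1" using xy by (simp add: algebra_simps)
    fix z assume z: "z \<in> upper_half_plane"
    have nz: "of_int c * z + of_int d \<noteq> 0" by (rule mobius_denominator_nonzero[OF z det])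
    define G E M where "G = (of_int g :: complex)" and "E = (of_int D :: complex)" and "M = (of_int (int m) :: complex)"
    have E: "E \<noteq> 0" using D0 by (simp add: E_def)
    have n: "of_int a' * (G * z + of_int B) + of_int (- y) * E = M * (of_int a * z + of_int b)"
    proof -
      have "of_int a' * (G * z + of_int B) + of_int (- y) * E = of_int (g * a') * z + of_int (a' * B - y * D)"
        by (simp add: G_def E_def algebra_simps)
      also have "\<dots> = M * (of_int a * z + of_int b)"
        unfolding a'[symmetric] e1 M_def by (simp add: algebra_simps)
      finally show ?thesis .
    qed
    have d: "of_int c' * (G * z + of_int B) + of_int x * E = of_int c * z + of_int d"
    proof -
      have "of_int c' * (G * z + of_int B) + of_int x * E = of_int (g * c') * z + of_int (c' * B + x * D)"
        by (simp add: G_def E_def algebra_simps)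
      then show ?thesis by (simp only: c'[symmetric] e2)
    qed
    have "mobius (a', - y, c', x) ((G * z + of_int B) / E) =
        ((of_int a' * (G * z + of_int B) + of_int (- y) * E) / E) / ((of_int c' * (G * z + of_int B) + of_int x * E) / E)"
    proof -
      have div: "p * (q / E) + r = (p * q + r * E) / E" for p q r
        using E by (simp add: add_divide_distrib)
      show ?thesis unfolding mobius_def prod.case div ..
    qed
    also have "\<dots> = M * mobius (a, b, c, d) z"
      unfolding n d using E nz by (simp add: mobius_def)
    finally show "of_nat m * mobius (a, b, c, d) z =
        mobius (a', - y, c', x) ((of_nat (nat g) * z + of_int B) / of_nat (nat D))"
      using g D0 by (simp add: G_def E_def M_def)
  qed
qed

corollary log_eta_norm_scaled_mobius:
  fixes m :: nat
  assumes "m > 0" "a * d - b * c = 1"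
  obtains A D :: nat and B :: int
  where "A * D = m" "\<And>z. z \<in> upper_half_plane \<Longrightarrow>
    log_eta_norm (of_nat m * mobius (a, b, c, d) z) = log_eta_norm ((of_nat A * z + of_int B) / of_nat D)"
proof -
  from scaled_mobius_decomposition[OF assms] obtain A D :: nat and B a' b' c' d' :: int
    where *: "A * D = m" "a' * d' - b' * c' = 1"
    "\<And>z. z \<in> upper_half_plane \<Longrightarrow> of_nat m * mobius (a, b, c, d) z =
       mobius (a', b', c', d') ((of_nat A * z + of_int B) / of_nat D)" by metis
  have "A > 0" "D > 0" using *(1) assms(1) by (auto intro: Nat.gr0I)
  then have "(of_nat A * z + of_int B) / of_nat D \<in> upper_half_plane" if "z \<in> upper_half_plane" for z
    using that by (simp add: upper_half_plane_def Im_divide_of_nat)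
  with * show ?thesis by (intro that[of A D B]) (auto simp: log_eta_norm_mobius)
qed

section \<open>Divisor sums with trivial characters\<close>

lemma character_conductor_trivial:
  assumes "M \<ge> 1"
  shows "character_conductor M (trivial_character M) = 1"
proof -
  have "induces 1 (\<lambda>_. 1) M (trivial_character M)"
    by (simp add: induces_def dirichlet_character_def trivial_character_def)
  then show ?thesis
    unfolding character_conductor_def
    by (intro Least_equality) (auto simp: induces_def dirichlet_character_def Suc_le_eq)
qed

text \<open>A character of modulus 1 has period 1, hence takes its value at 1 everywhere.\<close>

lemma primitive_inducing_trivial:
  assumes "M \<ge> 1"
  shows "primitive_inducing M (trivial_character M) = (\<lambda>_. 1)"
  unfolding primitive_inducing_def character_conductor_trivial[OF assms]
proof (rule the_equality)
  show "induces 1 (\<lambda>_. 1) M (trivial_character M)"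
    by (simp add: induces_def dirichlet_character_def trivial_character_def)
  fix chi :: "int \<Rightarrow> complex" assume "induces 1 chi M (trivial_character M)"
  then have chi: "chi 1 = 1" "\<And>a. chi (a + 1) = chi a"
    by (auto simp: induces_def dirichlet_character_def)
  show "chi = (\<lambda>_. 1)"
  proof
    show "chi a = 1" for a
      by (induction a rule: int_induct[of _ 1]) (use chi in \<open>auto simp flip: chi(2)[of "_ - 1"]\<close>)
  qed
qed

text \<open>Fix a prime p dividing n. The squarefree divisors split into pairs d, p d with d prime
  to p, and the two values in each pair cancel.\<close>

lemma sum_moebius_mu_divisors:
  fixes n :: nat
  assumes "n > 0"
  shows "(\<Sum>d | d dvd n. moebius_mu d) = (if n = 1 then 1 else 0)"
proof (cases "n = 1")
  case True
  then show ?thesis by (simp add: moebius_mu_def)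
next
  case False
  then obtain p where p: "prime p" "p dvd n" using prime_factor_nat by blast
  define A where "A = {d. d dvd n \<and> squarefree d \<and> \<not> p dvd d}"
  have fin: "finite {d. d dvd n}" using assms by simp
  have finA: "finite A" unfolding A_def by (rule finite_subset[OF _ fin]) auto
  have cop: "coprime p d" if "d \<in> A" for d using p that by (auto simp: A_def prime_imp_coprime)
  have mem: "p * d dvd n" "squarefree (p * d)" if "d \<in> A" for d
    using that p cop[OF that]
    by (auto simp: A_def squarefree_mult_coprime squarefree_prime divides_mult)
  have mu: "moebius_mu (p * d) = - moebius_mu d" if "d \<in> A" for d
  proof -
    have d: "squarefree d" "d \<noteq> 0" "\<not> p dvd d" using that by (auto simp: A_def intro!: Nat.gr0I)
    have "prime_factors (p * d) = insert p (prime_factors d)"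
      using p d by (simp add: prime_factors_product prime_prime_factors)
    moreover have "p \<notin> prime_factors d" using d by (auto dest: in_prime_factors_imp_dvd)
    ultimately show ?thesis using mem(2)[OF that] d by (simp add: moebius_mu_def)
  qed
  have split: "{d. d dvd n \<and> squarefree d} = A \<union> (*) p ` A"
  proof (intro equalityI subsetI)
    fix d assume d: "d \<in> {d. d dvd n \<and> squarefree d}"
    show "d \<in> A \<union> (*) p ` A"
    proof (cases "p dvd d")
      case True
      then obtain e where e: "d = p * e" by (elim dvdE)
      have "squarefree e" using d e squarefree_multD by blast
      moreover have "\<not> p dvd e"
      proof
        assume "p dvd e"
        then have "p ^ 2 dvd d" by (simp add: e power2_eq_square mult_dvd_mono)
        then have "is_unit p" using d by (auto dest: squarefreeD)
        then show False using p by auto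
      qed
      moreover have "e dvd n" using d e by (auto dest: dvd_mult_right)
      ultimately show ?thesis by (auto simp: A_def e)
    qed (use d in \<open>auto simp: A_def\<close>)
  qed (use mem in \<open>auto simp: A_def\<close>)
  have "(\<Sum>d | d dvd n. moebius_mu d) = (\<Sum>d | d dvd n \<and> squarefree d. moebius_mu d)"
    by (rule sum.mono_neutral_right[OF fin]) (auto simp: moebius_mu_def)
  also have "\<dots> = sum moebius_mu A + sum moebius_mu ((*) p ` A)"
    unfolding split by (intro sum.union_disjoint finite_imageI finA) (auto simp: A_def)
  also have "sum moebius_mu ((*) p ` A) = (\<Sum>d\<in>A. moebius_mu (p * d))"
    using p by (subst sum.reindex) (auto simp: inj_on_def prime_gt_0_nat)
  also have "\<dots> = - sum moebius_mu A" by (simp add: mu sum_negf)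
  finally show ?thesis using False by simp
qed

lemma trivial_character_moebius:
  fixes L k :: nat
  assumes "L \<ge> 1"
  shows "trivial_character L (int k) = (\<Sum>e | e dvd L \<and> e dvd k. of_int (moebius_mu e))"
proof -
  have "(\<Sum>e | e dvd L \<and> e dvd k. of_int (moebius_mu e) :: complex) = of_int (\<Sum>e | e dvd gcd k L. moebius_mu e)"
    by (simp add: conj_commute)
  also have "\<dots> = (if gcd k L = 1 then 1 else 0)"
    using assms by (subst sum_moebius_mu_divisors) auto
  finally show ?thesis by (simp add: trivial_character_def coprime_iff_gcd_eq_1 gcd_int_int_eq)
qed

text \<open>With c = d c' and n / c = e f one has n = d e c' f, so c' runs over the divisors of n /
  (d e).\<close>

lemma sum_multiples_dividing:
  fixes n d e :: nat
  assumes "n > 0" "d > 0" "e > 0"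
  shows "(\<Sum>c | c dvd n \<and> d dvd c \<and> e dvd n div c. c) =
     (if d * e dvd n then d * divisor_sum (n div (d * e)) else 0)"
proof (cases "d * e dvd n")
  case True
  then obtain k where k: "n = d * e * k" by (elim dvdE)
  have k0: "k > 0" using k assms by (intro Nat.gr0I) auto
  have "(\<Sum>c | c dvd n \<and> d dvd c \<and> e dvd n div c. c) = (\<Sum>c | c dvd k. d * c)"
  proof (rule sum.reindex_bij_witness[of _ "\<lambda>c. d * c" "\<lambda>c. c div d"])
    fix c assume "c \<in> {c. c dvd n \<and> d dvd c \<and> e dvd n div c}"
    then obtain c' f where c: "c = d * c'" "n div c = e * f" "c dvd n" unfolding mem_Collect_eq by (metis dvdE)
    then have "n = d * e * (c' * f)" by (metis dvd_mult_div_cancel mult.assoc mult.left_commute)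
    with k assms have "k = c' * f" by simp
    then show "d * (c div d) = c" "c div d \<in> {c. c dvd k}" "d * (c div d) = c" using c assms by auto
  next
    fix c assume "c \<in> {c. c dvd k}"
    then obtain f where f: "k = c * f" by (auto elim!: dvdE)
    have "n = (d * c) * (e * f)" by (simp add: k f mult_ac)
    moreover have "d * c > 0" using assms f k0 by auto
    ultimately show "d * c div d = c" "d * c \<in> {c. c dvd n \<and> d dvd c \<and> e dvd n div c}" using assms by auto
  qed
  then show ?thesis using True k assms by (simp add: divisor_sum_def sum_distrib_left)
next
  case False
  have "\<not> (c dvd n \<and> d dvd c \<and> e dvd n div c)" for c
  proof
    assume c: "c dvd n \<and> d dvd c \<and> e dvd n div c"
    then have "d * e dvd c * (n div c)" by (intro mult_dvd_mono) auto
    with c False show False by simp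
  qed
  then have "{c. c dvd n \<and> d dvd c \<and> e dvd n div c} = {}" by blast
  then show ?thesis using False by (simp only: sum.empty if_False)
qed

text \<open>The coefficient of sigma(n / (d e)) in sigma_1^{1_L, 1_M}(n). One factor d is explicit
  in the Ramanujan sum, the other comes from the substitution c = d c'.\<close>

definition level_weight :: "nat \<Rightarrow> nat \<times> nat \<Rightarrow> real" where
  "level_weight M = (\<lambda>(d, e). real d ^ 2 * real_of_int (moebius_mu (M div d)) * real_of_int (moebius_mu e))"

abbreviation level_divisors :: "nat \<Rightarrow> nat \<Rightarrow> (nat \<times> nat) set" where
  "level_divisors L M \<equiv> {d. d dvd M} \<times> {e. e dvd L}"

definition divisor_sum_at :: "nat \<Rightarrow> nat \<Rightarrow> complex" where
  "divisor_sum_at k n = (if k dvd n then of_nat (divisor_sum (n div k)) else 0)"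

lemma sigma1_triv_eq:
  assumes "L \<ge> 1" "M \<ge> 1"
  shows "sigma1_triv L M n = (\<Sum>(d, e) \<in> level_divisors L M. of_real (level_weight M (d, e)) * divisor_sum_at (d * e) n)"
proof (cases "n = 0")
  case True
  then show ?thesis by (simp add: sigma1_def divisor_sum_at_def)
next
  case False
  define \<mu> where "\<mu> k = (of_int (moebius_mu k) :: complex)" for k
  have fin: "finite {d. d dvd M}" "finite {e. e dvd L}" "finite {c. c dvd n}" using assms False by auto
  have "sigma1_triv L M n = (\<Sum>c | c dvd n. trivial_character L (int (n div c)) * of_nat c *
      (\<Sum>d | d dvd M \<and> d dvd c. of_nat d * \<mu> (M div d)))"
    using assms False
    by (auto simp: sigma1_def character_conductor_trivial primitive_inducing_trivial \<mu>_def Let_def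
        intro!: sum.cong Nat.gr0I)
  also have "\<dots> = (\<Sum>c | c dvd n. \<Sum>d | d dvd M. \<Sum>e | e dvd L.
      if d dvd c \<and> e dvd n div c then of_nat d * \<mu> (M div d) * \<mu> e * of_nat c else 0)"
  proof (intro sum.cong refl)
    fix c assume "c \<in> {c. c dvd n}"
    have 1: "trivial_character L (int (n div c)) = (\<Sum>e | e dvd L. if e dvd n div c then \<mu> e else 0)"
      unfolding trivial_character_moebius[OF assms(1)] \<mu>_def
      using fin by (simp add: sum.inter_filter[symmetric])
    have 2: "(\<Sum>d | d dvd M \<and> d dvd c. of_nat d * \<mu> (M div d)) =
        (\<Sum>d | d dvd M. if d dvd c then of_nat d * \<mu> (M div d) else 0)"
      using fin by (simp add: sum.inter_filter[symmetric])
    show "trivial_character L (int (n div c)) * of_nat c * (\<Sum>d | d dvd M \<and> d dvd c. of_nat d * \<mu> (M div d)) =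
       (\<Sum>d | d dvd M. \<Sum>e | e dvd L. if d dvd c \<and> e dvd n div c then of_nat d * \<mu> (M div d) * \<mu> e * of_nat c else 0)"
      unfolding 1 2 sum_distrib_left sum_distrib_right
      by (intro sum.cong refl) auto
  qed
  \<comment> \<open>With the sum over c innermost, \<open>sum_multiples_dividing\<close> evaluates
    it.\<close>
  also have "\<dots> = (\<Sum>d | d dvd M. \<Sum>e | e dvd L. \<Sum>c | c dvd n.
      if d dvd c \<and> e dvd n div c then of_nat d * \<mu> (M div d) * \<mu> e * of_nat c else 0)"
    by (subst sum.swap) (intro sum.cong refl sum.swap)
  also have "\<dots> = (\<Sum>d | d dvd M. \<Sum>e | e dvd L. of_real (level_weight M (d, e)) * divisor_sum_at (d * e) n)"
  proof (intro sum.cong refl)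
    fix d e assume de: "d \<in> {d. d dvd M}" "e \<in> {e. e dvd L}"
    have "(\<Sum>c | c dvd n. if d dvd c \<and> e dvd n div c then of_nat d * \<mu> (M div d) * \<mu> e * of_nat c else 0) =
        of_nat d * \<mu> (M div d) * \<mu> e * of_nat (\<Sum>c | c dvd n \<and> d dvd c \<and> e dvd n div c. c)"
      using fin by (simp add: sum.inter_filter[symmetric] sum_distrib_left)
    also have "\<dots> = of_real (level_weight M (d, e)) * divisor_sum_at (d * e) n"
      using de assms False
      by (subst sum_multiples_dividing)
         (auto simp: divisor_sum_at_def level_weight_def \<mu>_def power2_eq_square intro!: Nat.gr0I)
    finally show "(\<Sum>c | c dvd n. if d dvd c \<and> e dvd n div c then of_nat d * \<mu> (M div d) * \<mu> e * of_nat c else 0) =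
        of_real (level_weight M (d, e)) * divisor_sum_at (d * e) n" .
  qed
  finally show ?thesis by (simp add: sum.cartesian_product)
qed

lemma sums_multiples:
  fixes a :: "nat \<Rightarrow> complex"
  assumes "k > 0" "(\<lambda>n. a n * (w ^ k) ^ n) sums S"
  shows "(\<lambda>n. (if k dvd n then a (n div k) else 0) * w ^ n) sums S"
proof -
  have "(\<lambda>n. (if k dvd k * n then a (k * n div k) else 0) * w ^ (k * n)) sums S"
    using assms by (simp add: power_mult)
  then show ?thesis
    using assms(1)
    by (subst (asm) sums_mono_reindex[of "\<lambda>n. k * n" "\<lambda>n. (if k dvd n then a (n div k) else 0) * w ^ n"])
       (auto simp: strict_mono_def)
qed

section \<open>The constant term of the Eisenstein series\<close>

text \<open>The term at n = 0 is 1 / 0 = 0, so the series may start there; this fits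
  \<open>sums_multiples\<close>, where 0 counts as a multiple.\<close>

lemma zeta_2_sums: "(\<lambda>n. 1 / of_nat n ^ 2 :: complex) sums of_real (pi\<^sup>2 / 6)"
proof -
  have "(\<lambda>n. complex_of_real (1 / (real (Suc n))\<^sup>2)) sums of_real (pi\<^sup>2 / 6)"
    using inverse_squares_sums by (intro sums_of_real) (simp add: add.commute)
  then have "(\<lambda>n. 1 / of_nat (Suc n) ^ 2 :: complex) sums of_real (pi\<^sup>2 / 6)" by simp
  then show ?thesis by (subst (asm) sums_Suc_iff) simp
qed

lemma trivial_character_L2:
  assumes "M \<ge> 1"
  shows "(\<lambda>n. trivial_character M (int (Suc n)) / of_nat (Suc n) ^ 2) sums
     (\<Sum>e | e dvd M. of_int (moebius_mu e) / of_nat e ^ 2 * of_real (pi\<^sup>2 / 6))"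
proof -
  have fin: "finite {e. e dvd M}" using assms by simp
  have one: "(\<lambda>n. of_int (moebius_mu e) / of_nat e ^ 2 * ((if e dvd n then of_nat e ^ 2 / of_nat n ^ 2 else 0))) sums
      (of_int (moebius_mu e) / of_nat e ^ 2 * complex_of_real (pi\<^sup>2 / 6))" if "e \<in> {e. e dvd M}" for e
  proof -
    have e: "e > 0" using that assms by (auto intro: Nat.gr0I)
    have "(\<lambda>n. (if e dvd n then 1 / of_nat (n div e) ^ 2 else 0) * 1 ^ n) sums complex_of_real (pi\<^sup>2 / 6)"
      using zeta_2_sums by (intro sums_multiples e) simp
    also have "(\<lambda>n. (if e dvd n then 1 / of_nat (n div e) ^ 2 else 0) * 1 ^ n) =
       (\<lambda>n. if e dvd n then of_nat e ^ 2 / of_nat n ^ 2 else 0 :: complex)"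
      using e by (auto simp: fun_eq_iff power_mult_distrib elim!: dvdE)
    finally show ?thesis by (rule sums_mult)
  qed
  have "(\<lambda>n. \<Sum>e | e dvd M. of_int (moebius_mu e) / of_nat e ^ 2 * ((if e dvd n then of_nat e ^ 2 / of_nat n ^ 2 else 0))) sums
     (\<Sum>e | e dvd M. of_int (moebius_mu e) / of_nat e ^ 2 * complex_of_real (pi\<^sup>2 / 6))"
    by (intro sums_sum one)
  also have "(\<lambda>n. \<Sum>e | e dvd M. of_int (moebius_mu e) / of_nat e ^ 2 * ((if e dvd n then of_nat e ^ 2 / of_nat n ^ 2 else 0))) =
     (\<lambda>n. trivial_character M (int n) / of_nat n ^ 2 :: complex)"
  proof
    fix n
    have "(\<Sum>e | e dvd M. of_int (moebius_mu e) / of_nat e ^ 2 * ((if e dvd n then of_nat e ^ 2 / of_nat n ^ 2 else 0)) :: complex)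
       = (\<Sum>e | e dvd M. if e dvd n then of_int (moebius_mu e) / of_nat n ^ 2 else 0)"
      using assms by (intro sum.cong) auto
    also have "\<dots> = trivial_character M (int n) / of_nat n ^ 2"
      unfolding trivial_character_moebius[OF assms] sum_divide_distrib
      using fin by (simp add: sum.inter_filter[symmetric])
    finally show "(\<Sum>e | e dvd M. of_int (moebius_mu e) / of_nat e ^ 2 * ((if e dvd n then of_nat e ^ 2 / of_nat n ^ 2 else 0)) :: complex)
       = trivial_character M (int n) / of_nat n ^ 2" .
  qed
  finally show ?thesis by (subst sums_Suc_iff) simp
qed

text \<open>This matches the constant term with those of the functions E2 (d e z). The sum over e is
  the sum of mu over the divisors of L, which vanishes unless L = 1: this is the case distinction in
  \<open>C2\<close>. The substitution d -> M / d turns the sum over d into M^2 L(2, 1_M) /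
  zeta(2).\<close>

lemma C2_eq:
  assumes "L \<ge> 1" "M \<ge> 1"
  shows "C2 L M = of_real (pi\<^sup>2 / (6 * real M ^ 2) * (\<Sum>i \<in> level_divisors L M. level_weight M i))"
proof -
  have "(\<Sum>i \<in> level_divisors L M. level_weight M i) =
     (\<Sum>d | d dvd M. \<Sum>e | e dvd L. real d ^ 2 * real_of_int (moebius_mu (M div d)) * real_of_int (moebius_mu e))"
    by (simp add: sum.cartesian_product level_weight_def case_prod_beta)
  also have "\<dots> = (\<Sum>d | d dvd M. real d ^ 2 * real_of_int (moebius_mu (M div d))) * real_of_int (\<Sum>e | e dvd L. moebius_mu e)"
    by (simp add: sum_product)
  also have "(\<Sum>e | e dvd L. moebius_mu e) = (if L = 1 then 1 else 0)"
    using assms by (intro sum_moebius_mu_divisors) auto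
  also have "(\<Sum>d | d dvd M. real d ^ 2 * real_of_int (moebius_mu (M div d))) =
     (\<Sum>e | e dvd M. real (M div e) ^ 2 * real_of_int (moebius_mu e))"
    using assms by (intro sum.reindex_bij_witness[of _ "\<lambda>e. M div e" "\<lambda>d. M div d"]) (auto elim!: dvdE)
  also have "\<dots> = real M ^ 2 * (\<Sum>e | e dvd M. real_of_int (moebius_mu e) / real e ^ 2)"
    unfolding sum_distrib_left by (intro sum.cong) (auto simp: real_of_nat_div power_divide)
  finally have "pi\<^sup>2 / (6 * real M ^ 2) * (\<Sum>i \<in> level_divisors L M. level_weight M i) =
     (if L = 1 then (\<Sum>e | e dvd M. real_of_int (moebius_mu e) / real e ^ 2 * (pi\<^sup>2 / 6)) else 0)"
    using assms by (simp add: sum_distrib_left mult.commute)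
  then show ?thesis
    using trivial_character_L2[OF assms(2)] by (simp add: C2_def sums_iff)
qed

section \<open>Real parts of holomorphic functions\<close>

text \<open>The splitting of F is assumed only on an open set, since it will be available only in
  the upper half-plane; openness suffices for transferring derivatives.\<close>

lemma partial_x_twice_Re:
  assumes "open S" "z \<in> S" "\<And>w. w \<in> S \<Longrightarrow> F w = g w + cnj (g w)"
    and "(g has_field_derivative g') (at z)"
  shows "partial_x F z = g' + cnj g'"
proof -
  have 1: "((\<lambda>s. g (z + of_real s)) has_vector_derivative g') (at 0)"
  proof -
    have "((\<lambda>s. z + complex_of_real s) has_vector_derivative 1) (at 0)"
      by (auto intro!: derivative_eq_intros)
    from field_vector_diff_chain_at[OF this, of g g'] assms(4) show ?thesis by (simp add: o_def)
  qed
  have "((\<lambda>s. g (z + of_real s) + cnj (g (z + of_real s))) has_vector_derivative g' + cnj g') (at 0)"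
    by (intro has_vector_derivative_add 1 bounded_linear.has_vector_derivative[OF bounded_linear_cnj])
  moreover have "open ((\<lambda>s. z + complex_of_real s) -` S)"
    by (intro open_vimage assms continuous_intros)
  ultimately have "((\<lambda>s. F (z + of_real s)) has_vector_derivative g' + cnj g') (at 0)"
    by (rule has_vector_derivative_transform_within_open) (use assms in auto)
  then show ?thesis unfolding partial_x_def by (rule vector_derivative_at)
qed

lemma partial_y_twice_Re:
  assumes "open S" "z \<in> S" "\<And>w. w \<in> S \<Longrightarrow> F w = g w + cnj (g w)"
    and "(g has_field_derivative g') (at z)"
  shows "partial_y F z = \<i> * g' + cnj (\<i> * g')"
proof -
  have 1: "((\<lambda>s. g (z + \<i> * of_real s)) has_vector_derivative \<i> * g') (at 0)"
  proof -
    have "((\<lambda>s. z + \<i> * complex_of_real s) has_vector_derivative \<i>) (at 0)"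
      by (auto intro!: derivative_eq_intros)
    from field_vector_diff_chain_at[OF this, of g g'] assms(4) show ?thesis by (simp add: o_def)
  qed
  have "((\<lambda>s. g (z + \<i> * of_real s) + cnj (g (z + \<i> * of_real s))) has_vector_derivative \<i> * g' + cnj (\<i> * g')) (at 0)"
    by (intro has_vector_derivative_add 1 bounded_linear.has_vector_derivative[OF bounded_linear_cnj])
  moreover have "open ((\<lambda>s. z + \<i> * complex_of_real s) -` S)"
    by (intro open_vimage assms continuous_intros)
  ultimately have "((\<lambda>s. F (z + \<i> * of_real s)) has_vector_derivative \<i> * g' + cnj (\<i> * g')) (at 0)"
    by (rule has_vector_derivative_transform_within_open) (use assms in auto)
  then show ?thesis unfolding partial_y_def by (rule vector_derivative_at)
qed

text \<open>The derivative with respect to the conjugate variable kills g and sends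
  \<open>cnj g\<close> to \<open>cnj g'\<close>; xi_0 conjugates once more.\<close>

lemma xi0_twice_Re:
  assumes "open S" "z \<in> S" "\<And>w. w \<in> S \<Longrightarrow> F w = g w + cnj (g w)"
    and "(g has_field_derivative g') (at z)"
  shows "xi0 F z = 2 * \<i> * g'"
  by (simp add: xi0_def partial_zbar_def partial_x_twice_Re[OF assms] partial_y_twice_Re[OF assms] algebra_simps)

text \<open>The first partial derivatives are again twice real parts, of g' and of i g', so the same
  rules apply a second time and yield g'' and i^2 g''.\<close>

lemma harmonic_twice_Re:
  assumes S: "open S" "z \<in> S" and F: "\<And>w. w \<in> S \<Longrightarrow> F w = g w + cnj (g w)"
    and g: "g holomorphic_on S"
  shows "partial_x (partial_x F) z + partial_y (partial_y F) z = 0"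
proof -
  have d: "(g has_field_derivative deriv g w) (at w)" if "w \<in> S" for w
    using holomorphic_derivI[OF g S(1) that] .
  have d2: "(deriv g has_field_derivative deriv (deriv g) z) (at z)"
    using holomorphic_derivI[OF holomorphic_deriv[OF g S(1)] S] .
  have "partial_x (partial_x F) z = deriv (deriv g) z + cnj (deriv (deriv g) z)"
    by (rule partial_x_twice_Re[OF S _ d2]) (rule partial_x_twice_Re[OF S(1) _ F d])
  moreover have "partial_y (partial_y F) z = \<i> * (\<i> * deriv (deriv g) z) + cnj (\<i> * (\<i> * deriv (deriv g) z))"
    by (rule partial_y_twice_Re[where g = "\<lambda>w. \<i> * deriv g w", OF S _ DERIV_cmult[OF d2]])
       (rule partial_y_twice_Re[OF S(1) _ F d])
  ultimately show ?thesis by simp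
qed

section \<open>From Taylor series to double power series\<close>

text \<open>Each power (x + i y)^n of the Taylor series is expanded binomially. The norms of the
  terms of degree n add up to \<open>norm (c n)\<close> times (|x| + |y|)^n, so absolute convergence
  follows from |x| + |y| < R, which the bounds R / 2 guarantee.\<close>

lemma holomorphic_has_sum_two_variables:
  assumes g: "g holomorphic_on ball z R" and xy: "\<bar>x\<bar> < R / 2" "\<bar>y\<bar> < R / 2"
  shows "((\<lambda>(i, j). (deriv ^^ (i + j)) g z / fact (i + j) * of_nat ((i + j) choose i) * \<i> ^ j *
            of_real x ^ i * of_real y ^ j) has_sum g (z + Complex x y)) UNIV"
proof -
  define c where "c n = (deriv ^^ n) g z / fact n" for n
  define s where "s = \<bar>x\<bar> + \<bar>y\<bar>"
  define h where "h = (\<lambda>(n, i). c n * (of_nat (n choose i) * of_real x ^ i * (\<i> * of_real y) ^ (n - i)))"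
  have ps: "(\<lambda>n. c n * w ^ n) sums g (z + w)" if "norm w < R" for w
    using holomorphic_power_series[OF g, of "z + w"] that by (simp add: c_def dist_norm)
  have sR: "s < R" "s \<ge> 0" using xy by (auto simp: s_def)
  define s' where "s' = (s + R) / 2"
  have s': "norm (complex_of_real s') < R" "s < s'" using sR by (auto simp: s'_def simp del: of_real_add of_real_divide)
  have abs: "summable (\<lambda>n. norm (c n) * s ^ n)"
  proof -
    have "summable (\<lambda>n. norm (c n * of_real s ^ n))"
      using ps[OF s'(1)] s'(2) sR(2) by (intro powser_insidea[of c "of_real s'"]) (auto simp: sums_iff)
    then show ?thesis using sR by (simp add: norm_mult norm_power)
  qed
  have xyC: "of_real x + \<i> * of_real y = Complex x y" by (simp add: complex_eq_iff)
  have nC: "norm (Complex x y) \<le> s"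
    using cmod_le[of "Complex x y"] by (simp add: s_def)
  have outer: "((\<lambda>n. c n * Complex x y ^ n) has_sum g (z + Complex x y)) UNIV"
  proof (rule norm_summable_imp_has_sum)
    show "summable (\<lambda>n. norm (c n * Complex x y ^ n))"
      by (rule summable_comparison_test'[OF abs])
         (use nC in \<open>auto simp: norm_mult norm_power intro!: mult_left_mono power_mono\<close>)
    show "(\<lambda>n. c n * Complex x y ^ n) sums g (z + Complex x y)"
      using nC sR by (intro ps) auto
  qed
  have inner: "((\<lambda>i. h (n, i)) has_sum c n * Complex x y ^ n) {..n}" for n
    by (intro has_sum_finiteI) (simp_all add: h_def binomial_ring sum_distrib_left flip: xyC)
  have "(\<lambda>p. norm (h p)) summable_on Sigma UNIV (\<lambda>n. {..n})"
  proof (rule summable_on_SigmaI)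
    show "((\<lambda>i. norm (h (n, i))) has_sum norm (c n) * s ^ n) {..n}" for n
      by (intro has_sum_finiteI)
         (simp_all add: h_def s_def binomial_ring sum_distrib_left norm_mult norm_power)
    show "(\<lambda>n. norm (c n) * s ^ n) summable_on UNIV"
      using abs sR by (subst summable_on_UNIV_nonneg_real_iff) auto
  qed auto
  then have "h summable_on Sigma UNIV (\<lambda>n. {..n})" by (rule abs_summable_summable)
  then have "(h has_sum g (z + Complex x y)) (Sigma UNIV (\<lambda>n. {..n}))"
    by (intro has_sum_SigmaI[OF inner outer])
  also have "?this \<longleftrightarrow> ?thesis"
    by (rule has_sum_reindex_bij_witness[of _ "\<lambda>(i, j). (i + j, i)" "\<lambda>(n, i). (i, n - i)"])
       (auto simp: h_def c_def power_mult_distrib)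
  finally show ?thesis .
qed

lemma real_analytic_twice_Re:
  assumes S: "open S" and F: "\<And>w. w \<in> S \<Longrightarrow> F w = g w + cnj (g w)"
    and g: "g holomorphic_on S"
  shows "real_analytic_on F S"
  unfolding real_analytic_on_def
proof
  fix z assume z: "z \<in> S"
  then obtain R where R: "R > 0" "ball z R \<subseteq> S" using S by (meson open_contains_ball)
  define a where "a = (\<lambda>(i, j). (deriv ^^ (i + j)) g z / fact (i + j) * of_nat ((i + j) choose i) * \<i> ^ j)"
  show "\<exists>r>0. \<exists>a. \<forall>x y. \<bar>x\<bar> < r \<and> \<bar>y\<bar> < r \<longrightarrow>
       ((\<lambda>(i, j). a (i, j) * of_real x ^ i * of_real y ^ j) has_sum F (z + Complex x y)) UNIV"
  \<comment> \<open>Since x and y are real, conjugating the series of g only conjugates its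
    coefficients.\<close>
  proof (rule exI[of _ "R / 2"], intro conjI exI[of _ "\<lambda>p. a p + cnj (a p)"] allI impI)
    show "R / 2 > 0" using R by simp
    fix x y :: real assume xy: "\<bar>x\<bar> < R / 2 \<and> \<bar>y\<bar> < R / 2"
    have "((\<lambda>(i, j). a (i, j) * of_real x ^ i * of_real y ^ j) has_sum g (z + Complex x y)) UNIV"
      using holomorphic_has_sum_two_variables[OF holomorphic_on_subset[OF g R(2)], of x y] xy
      by (simp add: a_def)
    from has_sum_add[OF this has_sum_cnj_iff[THEN iffD2, OF this]]
    have "((\<lambda>p. (case p of (i, j) \<Rightarrow> a (i, j) * of_real x ^ i * of_real y ^ j) +
        cnj (case p of (i, j) \<Rightarrow> a (i, j) * of_real x ^ i * of_real y ^ j))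
        has_sum (g (z + Complex x y) + cnj (g (z + Complex x y)))) UNIV" .
    moreover have "z + Complex x y \<in> S"
    proof -
      have "norm (Complex x y) < R" using cmod_le[of "Complex x y"] xy by auto
      then show ?thesis using R by (auto simp: dist_norm)
    qed
    ultimately show "((\<lambda>(i, j). (a (i, j) + cnj (a (i, j))) * of_real x ^ i * of_real y ^ j) has_sum F (z + Complex x y)) UNIV"
      by (simp add: F case_prod_unfold distrib_right)
  qed
qed

section \<open>Combinations of logarithms of eta functions\<close>

text \<open>Arguments (A z + B) / D, not just m z, are allowed because these are what a matrix of
  the full modular group turns m z into. One growth bound and one q-expansion for this family then
  cover every cusp.\<close>

definition eta_comb ::
  "real \<Rightarrow> 'i set \<Rightarrow> ('i \<Rightarrow> real) \<Rightarrow> ('i \<Rightarrow> nat) \<Rightarrow> ('i \<Rightarrow> nat) \<Rightarrow> ('i \<Rightarrow> int) \<Rightarrow> complex \<Rightarrow> complex" where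
  "eta_comb K J w A D B z =
     of_real (K + (\<Sum>j\<in>J. w j * log_eta_norm ((of_nat (A j) * z + of_int (B j)) / of_nat (D j))))"

text \<open>If the weights sum to \<open>0\<close>, the logarithms of \<open>Im z\<close> cancel, and \<open>eta_comb\<close> is twice the
  real part of the following holomorphic function.\<close>

definition eta_comb_hol ::
  "real \<Rightarrow> 'i set \<Rightarrow> ('i \<Rightarrow> real) \<Rightarrow> ('i \<Rightarrow> nat) \<Rightarrow> ('i \<Rightarrow> nat) \<Rightarrow> ('i \<Rightarrow> int) \<Rightarrow> complex \<Rightarrow> complex" where
  "eta_comb_hol K J w A D B z = (of_real (K + (\<Sum>j\<in>J. w j * ln (real (A j) / real (D j)))) +
     (\<Sum>j\<in>J. of_real (w j) * log_eta4 ((of_nat (A j) * z + of_int (B j)) / of_nat (D j)))) / 2"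

definition eta_comb_hol' ::
  "'i set \<Rightarrow> ('i \<Rightarrow> real) \<Rightarrow> ('i \<Rightarrow> nat) \<Rightarrow> ('i \<Rightarrow> nat) \<Rightarrow> ('i \<Rightarrow> int) \<Rightarrow> complex \<Rightarrow> complex" where
  "eta_comb_hol' J w A D B z = (\<Sum>j\<in>J. of_real (w j) *
     (log_eta4' ((of_nat (A j) * z + of_int (B j)) / of_nat (D j)) * (of_nat (A j) / of_nat (D j)))) / 2"

lemma Im_affine:
  "Im ((of_nat A * z + of_int B) / of_nat D) = real A / real D * Im z"
  by (simp add: Im_divide_of_nat)

lemma affine_in_upper_half_plane:
  assumes "z \<in> upper_half_plane" "A > 0" "D > 0"
  shows "(of_nat A * z + of_int B) / of_nat D \<in> upper_half_plane"
  using assms by (simp add: upper_half_plane_def Im_affine)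

lemma eta_comb_eq:
  assumes w: "sum w J = 0" and pos: "\<And>j. j \<in> J \<Longrightarrow> A j > 0 \<and> D j > 0"
    and z: "z \<in> upper_half_plane"
  shows "eta_comb K J w A D B z = of_real (K + (\<Sum>j\<in>J. w j * ln (real (A j) / real (D j))) +
     (\<Sum>j\<in>J. w j * Re (log_eta4 ((of_nat (A j) * z + of_int (B j)) / of_nat (D j)))))"
proof -
  let ?a = "\<lambda>j. (of_nat (A j) * z + of_int (B j)) / of_nat (D j)"
  have "(\<Sum>j\<in>J. w j * log_eta_norm (?a j)) =
      (\<Sum>j\<in>J. w j * ln (real (A j) / real (D j)) + w j * ln (Im z) + w j * Re (log_eta4 (?a j)))"
  proof (rule sum.cong)
    fix j assume "j \<in> J"
    then have "ln (Im (?a j)) = ln (real (A j) / real (D j)) + ln (Im z)"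
      using pos[of j] z unfolding Im_affine by (subst ln_mult_pos) (auto simp: upper_half_plane_def)
    then show "w j * log_eta_norm (?a j) = w j * ln (real (A j) / real (D j)) + w j * ln (Im z) + w j * Re (log_eta4 (?a j))"
      by (simp add: log_eta_norm_def algebra_simps)
  qed auto
  also have "\<dots> = (\<Sum>j\<in>J. w j * ln (real (A j) / real (D j))) + (\<Sum>j\<in>J. w j * Re (log_eta4 (?a j)))"
    using w by (simp add: sum.distrib flip: sum_distrib_right)
  finally show ?thesis by (simp add: eta_comb_def)
qed

lemma eta_comb_twice_Re:
  assumes "sum w J = 0" "\<And>j. j \<in> J \<Longrightarrow> A j > 0 \<and> D j > 0" "z \<in> upper_half_plane"
  shows "eta_comb K J w A D B z = eta_comb_hol K J w A D B z + cnj (eta_comb_hol K J w A D B z)"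
proof -
  have "2 * Re (eta_comb_hol K J w A D B z) = K + (\<Sum>j\<in>J. w j * ln (real (A j) / real (D j))) +
     (\<Sum>j\<in>J. w j * Re (log_eta4 ((of_nat (A j) * z + of_int (B j)) / of_nat (D j))))"
    by (simp add: eta_comb_hol_def)
  with eta_comb_eq[OF assms, where K = K and B = B] show ?thesis by (simp only: complex_add_cnj)
qed

lemma eta_comb_hol_has_field_derivative:
  assumes "\<And>j. j \<in> J \<Longrightarrow> A j > 0 \<and> D j > 0" "z \<in> upper_half_plane"
  shows "(eta_comb_hol K J w A D B has_field_derivative eta_comb_hol' J w A D B z) (at z)"
proof -
  have "((\<lambda>z. of_real (w j) * log_eta4 ((of_nat (A j) * z + of_int (B j)) / of_nat (D j))) has_field_derivative
     (of_real (w j) * (log_eta4' ((of_nat (A j) * z + of_int (B j)) / of_nat (D j)) * (of_nat (A j) / of_nat (D j))))) (at z)"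
    if j: "j \<in> J" for j
  proof (intro DERIV_cmult DERIV_chain2[OF log_eta4_has_field_derivative])
    show "(of_nat (A j) * z + of_int (B j)) / of_nat (D j) \<in> upper_half_plane"
      using assms j by (intro affine_in_upper_half_plane) auto
    show "((\<lambda>z. (of_nat (A j) * z + of_int (B j)) / of_nat (D j)) has_field_derivative of_nat (A j) / of_nat (D j)) (at z)"
      using assms(1)[OF j] by (auto intro!: derivative_eq_intros)
  qed
  then have "((\<lambda>z. \<Sum>j\<in>J. of_real (w j) * log_eta4 ((of_nat (A j) * z + of_int (B j)) / of_nat (D j))) has_field_derivative
     (\<Sum>j\<in>J. of_real (w j) * (log_eta4' ((of_nat (A j) * z + of_int (B j)) / of_nat (D j)) * (of_nat (A j) / of_nat (D j))))) (at z)"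
    by (rule DERIV_sum)
  from DERIV_cdivide[OF DERIV_add[OF DERIV_const this], of _ 2] show ?thesis
    unfolding eta_comb_hol_def[abs_def] eta_comb_hol'_def by simp
qed

lemma eta_comb_hol_holomorphic:
  assumes "\<And>j. j \<in> J \<Longrightarrow> A j > 0 \<and> D j > 0"
  shows "eta_comb_hol K J w A D B holomorphic_on upper_half_plane"
  unfolding holomorphic_on_def field_differentiable_def
  by (intro ballI exI, rule has_field_derivative_at_within[OF eta_comb_hol_has_field_derivative[OF assms]])

lemma xi0_eta_comb:
  assumes "sum w J = 0" "\<And>j. j \<in> J \<Longrightarrow> A j > 0 \<and> D j > 0" "z \<in> upper_half_plane"
  shows "xi0 (eta_comb K J w A D B) z = 2 * \<i> * eta_comb_hol' J w A D B z"
  by (rule xi0_twice_Re[OF open_upper_half_plane assms(3) eta_comb_twice_Re eta_comb_hol_has_field_derivative])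
     (use assms in auto)

section \<open>Growth and q-expansion at infinity\<close>

lemma log_euler_fps_eval_bounded:
  "\<exists>C. \<forall>w. norm w \<le> 1 / 2 \<longrightarrow> norm (eval_fps log_euler_fps w) \<le> C"
proof -
  have "cball (0::complex) (1 / 2) \<subseteq> eball 0 (fps_conv_radius log_euler_fps)"
  proof
    fix w :: complex assume "w \<in> cball 0 (1 / 2)"
    then have "ereal (norm w) < 1" by auto
    then show "w \<in> eball 0 (fps_conv_radius log_euler_fps)"
      using order.strict_trans2[OF _ fps_conv_radius_log_euler_fps] by (simp add: in_eball_iff)
  qed
  then have "continuous_on (cball 0 (1 / 2)) (eval_fps log_euler_fps)"
    by (intro holomorphic_on_imp_continuous_on holomorphic_on_eval_fps)
  then have "bounded (eval_fps log_euler_fps ` cball 0 (1 / 2))"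
    by (intro compact_imp_bounded compact_continuous_image) auto
  then obtain C where "\<forall>x \<in> eval_fps log_euler_fps ` cball 0 (1 / 2). norm x \<le> C"
    unfolding bounded_iff by blast
  then show ?thesis by (intro exI[of _ C]) auto
qed

text \<open>For \<open>Im u \<ge> 1\<close> the real part of \<open>log_eta4 u\<close> is - (pi / 3)
  Im u up to a bounded error, so the combination grows at most linearly in
  \<open>Im z\<close>.\<close>

lemma eta_comb_growth:
  assumes J: "finite J" and w: "sum w J = 0" and pos: "\<And>j. j \<in> J \<Longrightarrow> A j > 0 \<and> D j > 0"
  shows "(\<lambda>z. norm (eta_comb K J w A D B z)) \<in> O[filtercomap Im at_top](\<lambda>z. exp (1 * Im z))"
proof -
  obtain C where C: "\<And>w. norm w \<le> 1 / 2 \<Longrightarrow> norm (eval_fps log_euler_fps w) \<le> C"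
    using log_euler_fps_eval_bounded by blast
  define a where "a j = real (A j) / real (D j)" for j
  define K' where "K' = K + (\<Sum>j\<in>J. w j * ln (a j))"
  define C1 where "C1 = \<bar>K'\<bar> + (\<Sum>j\<in>J. \<bar>w j\<bar> * (4 * C))"
  define C2 where "C2 = (\<Sum>j\<in>J. \<bar>w j\<bar> * (pi / 3 * a j))"
  \<comment> \<open>As every A is at least 1, \<open>Im z \<ge> D j\<close> already puts the
    argument with index j at height at least 1.\<close>
  define N where "N = max 1 (\<Sum>j\<in>J. real (D j))"
  have C0: "C \<ge> 0" using order_trans[OF norm_ge_zero C[of 0]] by simp
  have pos12: "C1 \<ge> 0" "C2 \<ge> 0"
    using C0 by (auto simp: C1_def C2_def a_def intro!: add_nonneg_nonneg sum_nonneg)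
  have bound: "norm (eta_comb K J w A D B z) \<le> (C1 + C2) * exp (Im z)" if z: "Im z \<ge> N" for z
  proof -
    have y1: "Im z \<ge> 1" using z by (simp add: N_def)
    have zU: "z \<in> upper_half_plane" using y1 by (simp add: upper_half_plane_def)
    have tm: "\<bar>Re (log_eta4 ((of_nat (A j) * z + of_int (B j)) / of_nat (D j)))\<bar> \<le> pi / 3 * a j * Im z + 4 * C"
      if j: "j \<in> J" for j
    proof -
      define u where "u = (of_nat (A j) * z + of_int (B j)) / of_nat (D j)"
      have Imu: "Im u = a j * Im z" by (simp only: u_def Im_affine a_def)
      have "real (D j) \<le> (\<Sum>j\<in>J. real (D j))" using J j by (intro member_le_sum) auto
      then have "real (D j) \<le> Im z" using z by (simp add: N_def)
      then have "1 \<le> Im z / real (D j)" using pos[OF j] by simp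
      also have "\<dots> \<le> a j * Im z"
        using pos[OF j] y1 by (auto simp: a_def divide_right_mono mult_le_cancel_right1)
      finally have u1: "Im u \<ge> 1" using Imu by simp
      have "norm (qexp u) \<le> 1 / 2"
      proof -
        have "2 \<le> 1 + 2 * pi * Im u" using u1 pi_ge_two
          by (smt (verit) mult_le_cancel_left1)
        also have "\<dots> \<le> exp (2 * pi * Im u)" by (rule exp_ge_add_one_self)
        finally show ?thesis by (simp add: norm_qexp exp_minus field_simps)
      qed
      then have "\<bar>Re (eval_fps log_euler_fps (qexp u))\<bar> \<le> C"
        using C abs_Re_le_cmod order_trans by blast
      moreover have "Re (log_eta4 u) = - (pi / 3 * a j * Im z) - 4 * Re (eval_fps log_euler_fps (qexp u))"
        by (simp add: log_eta4_def Imu)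
      moreover have "pi / 3 * a j * Im z \<ge> 0" using y1 by (simp add: a_def)
      ultimately show ?thesis unfolding u_def[symmetric] by linarith
    qed
    have "norm (eta_comb K J w A D B z) = \<bar>K' + (\<Sum>j\<in>J. w j * Re (log_eta4 ((of_nat (A j) * z + of_int (B j)) / of_nat (D j))))\<bar>"
      unfolding K'_def a_def by (subst eta_comb_eq[OF w pos zU], assumption, rule norm_of_real)
    also have "\<dots> \<le> \<bar>K'\<bar> + (\<Sum>j\<in>J. \<bar>w j * Re (log_eta4 ((of_nat (A j) * z + of_int (B j)) / of_nat (D j)))\<bar>)"
      by (rule order_trans[OF abs_triangle_ineq add_left_mono[OF sum_abs]])
    also have "\<dots> \<le> \<bar>K'\<bar> + (\<Sum>j\<in>J. \<bar>w j\<bar> * (pi / 3 * a j * Im z + 4 * C))"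
      unfolding abs_mult by (intro add_left_mono sum_mono mult_left_mono tm) auto
    also have "\<dots> = C1 + C2 * Im z"
      by (simp add: C1_def C2_def sum.distrib algebra_simps sum_distrib_left)
    also have "\<dots> \<le> C1 * exp (Im z) + C2 * exp (Im z)"
    proof (intro add_mono mult_left_mono pos12)
      show "Im z \<le> exp (Im z)" using exp_ge_add_one_self[of "Im z"] by linarith
      show "C1 \<le> C1 * exp (Im z)" using pos12 y1 by (simp add: mult_le_cancel_left1)
    qed
    finally show ?thesis by (simp add: algebra_simps)
  qed
  show ?thesis
    by (rule bigoI[of _ "C1 + C2"]) (use bound in \<open>auto simp: eventually_filtercomap_at_top_linorder\<close>)
qed

lemma qexp_of_nat_mult: "qexp (of_nat n * z) = qexp z ^ n"
  by (simp add: qexp_def exp_of_nat_mult[symmetric] mult_ac)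

text \<open>As h is a common multiple of the D, each \<open>qexp ((A z + B) / D)\<close> is a
  constant of norm 1 times a power of u = \<open>qexp (z / h)\<close>. The whole sum is then
  holomorphic in u on the unit disc, and its Taylor series is the expansion.\<close>

lemma eta_comb_hol'_q_expansion:
  assumes J: "finite J" and pos: "\<And>j. j \<in> J \<Longrightarrow> A j > 0 \<and> D j > 0"
    and h: "h > 0" "\<And>j. j \<in> J \<Longrightarrow> D j dvd h"
  shows "\<exists>coef. \<forall>z\<in>upper_half_plane.
     (\<lambda>n. coef n * qexp (of_nat n * z / of_nat h)) sums eta_comb_hol' J w A D B z"
proof -
  define k where "k j = A j * (h div D j)" for j
  define \<zeta> where "\<zeta> j = qexp (of_int (B j) / of_nat (D j))" for j
  define T where "T u = (\<Sum>j\<in>J. of_real (w j) * (of_real pi * \<i> / 3 * (1 - 24 * eval_fps divisor_fps (\<zeta> j * u ^ k j)) *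
      (of_nat (A j) / of_nat (D j)))) / 2" for u
  have k: "k j > 0" if "j \<in> J" for j using pos[OF that] h(1) h(2)[OF that] by (auto simp: k_def elim!: dvdE)
  have \<zeta>: "norm (\<zeta> j) = 1" for j by (simp add: \<zeta>_def norm_qexp Im_divide_of_nat)
  have "T holomorphic_on ball 0 1"
    unfolding T_def
  proof (intro holomorphic_intros)
    fix j assume j: "j \<in> J"
    have "(\<lambda>u. \<zeta> j * u ^ k j) ` ball 0 1 \<subseteq> ball 0 1"
      using k[OF j] by (auto simp: norm_mult \<zeta> norm_power power_less_one_iff)
    moreover have "eval_fps divisor_fps holomorphic_on ball 0 1"
    proof (rule holomorphic_on_eval_fps, rule subsetI)
      fix w :: complex assume "w \<in> ball 0 1"
      then have "ereal (norm w) < 1" by auto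
      then show "w \<in> eball 0 (fps_conv_radius divisor_fps)"
        using order.strict_trans2[OF _ fps_conv_radius_divisor_fps] by (simp add: in_eball_iff)
    qed
    moreover have "(\<lambda>u. \<zeta> j * u ^ k j) holomorphic_on ball 0 1" by (intro holomorphic_intros)
    ultimately show "(\<lambda>u. eval_fps divisor_fps (\<zeta> j * u ^ k j)) holomorphic_on ball 0 1"
      using holomorphic_on_compose_gen[of "\<lambda>u. \<zeta> j * u ^ k j" "ball 0 1" "eval_fps divisor_fps" "ball 0 1"]
      by (simp add: o_def)
  qed (use pos in auto)
  note T = holomorphic_power_series[OF this]
  show ?thesis
  proof (intro exI[of _ "\<lambda>n. (deriv ^^ n) T 0 / fact n"] ballI)
    fix z assume z: "z \<in> upper_half_plane"
    have "qexp (z / of_nat h) \<in> ball 0 1"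
      using norm_qexp_less_1[of "z / of_nat h"] z h(1) by (simp add: upper_half_plane_def Im_divide_of_nat)
    from T[OF this] have "(\<lambda>n. (deriv ^^ n) T 0 / fact n * qexp (z / of_nat h) ^ n) sums T (qexp (z / of_nat h))"
      by simp
    moreover have "T (qexp (z / of_nat h)) = eta_comb_hol' J w A D B z"
    proof -
      have "\<zeta> j * qexp (z / of_nat h) ^ k j = qexp ((of_nat (A j) * z + of_int (B j)) / of_nat (D j))" if j: "j \<in> J" for j
      proof -
        have "of_nat (k j) * (z / of_nat h) = of_nat (A j) * z / of_nat (D j)"
          using pos[OF j] h(1) h(2)[OF j] by (auto simp: k_def elim!: dvdE)
        then show ?thesis
          by (simp add: \<zeta>_def add_divide_distrib qexp_add mult.commute flip: qexp_of_nat_mult)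
      qed
      then show ?thesis by (simp add: T_def eta_comb_hol'_def log_eta4'_def)
    qed
    ultimately show "(\<lambda>n. (deriv ^^ n) T 0 / fact n * qexp (of_nat n * z / of_nat h)) sums eta_comb_hol' J w A D B z"
      by (simp add: qexp_of_nat_mult flip: times_divide_eq_right)
  qed
qed

section \<open>Modular behaviour and membership in H_0\<close>

text \<open>Only the arguments change, while constant and weights stay. The relation A' D' = A makes
  D' divide any multiple of A, so the level will serve as the width at every cusp.\<close>

lemma eta_comb_mobius:
  assumes pos: "\<And>j. j \<in> J \<Longrightarrow> A j > 0" and det: "a * d - b * c = 1"
  obtains A' D' B' where "\<And>j. j \<in> J \<Longrightarrow> A' j * D' j = A j"
    "\<And>z. z \<in> upper_half_plane \<Longrightarrow>
       eta_comb K J w A (\<lambda>_. 1) (\<lambda>_. 0) (mobius (a, b, c, d) z) = eta_comb K J w A' D' B' z"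
proof -
  have "\<exists>A' D' B'. A' * D' = A j \<and> (\<forall>z\<in>upper_half_plane.
     log_eta_norm (of_nat (A j) * mobius (a, b, c, d) z) = log_eta_norm ((of_nat A' * z + of_int B') / of_nat D'))"
    if "j \<in> J" for j
    using log_eta_norm_scaled_mobius[OF pos[OF that] det] by metis
  then obtain A' D' B' where *: "\<And>j. j \<in> J \<Longrightarrow> A' j * D' j = A j"
    "\<And>j z. j \<in> J \<Longrightarrow> z \<in> upper_half_plane \<Longrightarrow>
       log_eta_norm (of_nat (A j) * mobius (a, b, c, d) z) = log_eta_norm ((of_nat (A' j) * z + of_int (B' j)) / of_nat (D' j))"
    by metis
  then show ?thesis
    by (intro that[of A' D' B']) (auto simp: eta_comb_def intro!: sum.cong)
qed

lemma mobius_has_field_derivative: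
  assumes "z \<in> upper_half_plane" "a * d - b * c = 1"
  shows "(mobius (a, b, c, d) has_field_derivative 1 / (of_int c * z + of_int d)\<^sup>2) (at z)"
proof -
  have nz: "of_int c * z + of_int d \<noteq> 0" by (rule mobius_denominator_nonzero[OF assms])
  have "complex_of_int (a * d - b * c) = 1" using assms by simp
  then have det: "complex_of_int a * of_int d - of_int b * of_int c = 1" by simp
  have "((\<lambda>z. (of_int a * z + of_int b) / (of_int c * z + of_int d)) has_field_derivative
     (of_int a * (of_int c * z + of_int d) - (of_int a * z + of_int b) * of_int c) / (of_int c * z + of_int d)\<^sup>2) (at z)"
    using nz by (auto intro!: derivative_eq_intros simp: power2_eq_square)
  also have "of_int a * (of_int c * z + of_int d) - (of_int a * z + of_int b) * of_int c = 1"
    using det by (simp add: algebra_simps)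
  finally show ?thesis by (simp add: mobius_def)
qed

text \<open>Since m divides c, conjugation by diag(m, 1) keeps the matrix integral: m gamma z =
  gamma' (m z), where gamma' has rows (a, b m) and (c / m, d).\<close>

lemma log_eta_norm_Gamma0:
  assumes g: "(a, b, c, d) \<in> Gamma0 N" and z: "z \<in> upper_half_plane" and m: "m > 0" "m dvd N"
  shows "log_eta_norm (of_nat m * mobius (a, b, c, d) z) = log_eta_norm (of_nat m * z)"
proof -
  have det: "a * d - b * c = 1" and "int N dvd c" using g by (auto simp: Gamma0_def)
  then have "int m dvd c" using m(2) by (meson dvd_trans int_dvd_int_iff)
  then obtain c' where c: "c = int m * c'" by (elim dvdE)
  have "of_nat m * mobius (a, b, c, d) z = mobius (a, b * int m, c', d) (of_nat m * z)"
    using m(1) by (simp add: mobius_def c algebra_simps)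
  moreover have "a * d - (b * int m) * c' = 1" using det by (simp add: c algebra_simps)
  moreover have "of_nat m * z \<in> upper_half_plane" using z m(1) by (simp add: upper_half_plane_def)
  ultimately show ?thesis by (simp add: log_eta_norm_mobius)
qed

theorem eta_comb_in_H0:
  assumes J: "finite J" and w: "sum w J = 0" and A: "\<And>j. j \<in> J \<Longrightarrow> A j > 0 \<and> A j dvd N" and N: "N > 0"
  shows "eta_comb K J w A (\<lambda>_. 1) (\<lambda>_. 0) \<in> H0 N (trivial_character N)"
proof -
  let ?F = "eta_comb K J w A (\<lambda>_. 1) (\<lambda>_. 0)"
  let ?g = "eta_comb_hol K J w A (\<lambda>_. 1) (\<lambda>_. 0)"
  have Fg: "?F z = ?g z + cnj (?g z)" if "z \<in> upper_half_plane" for z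
    using A that by (intro eta_comb_twice_Re w) auto
  have hol: "?g holomorphic_on upper_half_plane"
    using A by (intro eta_comb_hol_holomorphic) auto
  have "real_analytic_on ?F upper_half_plane"
    by (rule real_analytic_twice_Re[OF open_upper_half_plane Fg hol])
  moreover have "transforms_with 0 N (trivial_character N) ?F"
    unfolding transforms_with_def
  proof clarify
    fix a b c d z assume g: "(a, b, c, d) \<in> Gamma0 N" and z: "z \<in> upper_half_plane"
    then have det: "a * d - b * c = 1" and Nc: "int N dvd c" by (auto simp: Gamma0_def)
    have "coprime d (int N)"
    proof (rule coprimeI)
      fix q assume "q dvd d" "q dvd int N"
      then have "q dvd a * d - b * c" using Nc by (meson dvd_diff dvd_mult dvd_trans)
      then show "is_unit q" using det by simp
    qed
    moreover have "?F (mobius (a, b, c, d) z) = ?F z"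
      unfolding eta_comb_def using log_eta_norm_Gamma0[OF g z] A by (auto intro!: sum.cong)
    ultimately show "?F (mobius (a, b, c, d) z) = trivial_character N d * (of_int c * z + of_int d) powi 0 * ?F z"
      by (simp add: trivial_character_def)
  qed
  moreover have "linear_exp_growth_at_cusps ?F"
    unfolding linear_exp_growth_at_cusps_def
  proof clarify
    fix a b c d assume "(a, b, c, d) \<in> Gamma0 1"
    then have det: "a * d - b * c = 1" by (auto simp: Gamma0_def)
    obtain A' D' B' where *: "\<And>j. j \<in> J \<Longrightarrow> A' j * D' j = A j"
      "\<And>z. z \<in> upper_half_plane \<Longrightarrow> ?F (mobius (a, b, c, d) z) = eta_comb K J w A' D' B' z"
      using eta_comb_mobius[of J A a d b c K w] A det by metis
    have "A' j > 0 \<and> D' j > 0" if "j \<in> J" for j using *(1)[OF that] A[OF that] by (metis mult_is_0 neq0_conv)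
    then have "(\<lambda>z. norm (eta_comb K J w A' D' B' z)) \<in> O[filtercomap Im at_top](\<lambda>z. exp (1 * Im z))"
      by (intro eta_comb_growth J w)
    moreover have "\<forall>\<^sub>F z in filtercomap Im at_top. norm (?F (mobius (a, b, c, d) z)) = norm (eta_comb K J w A' D' B' z)"
      unfolding eventually_filtercomap_at_top_linorder
      by (rule exI[of _ 1]) (use * in \<open>auto simp: upper_half_plane_def\<close>)
    ultimately show "\<exists>C. (\<lambda>z. norm (?F (mobius (a, b, c, d) z))) \<in> O[filtercomap Im at_top](\<lambda>z. exp (C * Im z))"
      by (intro exI[of _ 1]) (simp only: landau_o.big.in_cong)
  qed
  moreover have "holomorphic_at_cusps 2 (xi0 ?F)"
    unfolding holomorphic_at_cusps_def
  proof clarify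
    fix a b c d assume "(a, b, c, d) \<in> Gamma0 1"
    then have det: "a * d - b * c = 1" by (auto simp: Gamma0_def)
    obtain A' D' B' where *: "\<And>j. j \<in> J \<Longrightarrow> A' j * D' j = A j"
      "\<And>z. z \<in> upper_half_plane \<Longrightarrow> ?F (mobius (a, b, c, d) z) = eta_comb K J w A' D' B' z"
      using eta_comb_mobius[of J A a d b c K w] A det by metis
    have pos: "A' j > 0 \<and> D' j > 0" if "j \<in> J" for j using *(1)[OF that] A[OF that] by (metis mult_is_0 neq0_conv)
    have "D' j dvd N" if "j \<in> J" for j using *(1)[OF that] A[OF that] by (metis dvd_trans dvd_triv_right)
    then obtain coef where coef: "\<And>z. z \<in> upper_half_plane \<Longrightarrow>
       (\<lambda>n. coef n * qexp (of_nat n * z / of_nat N)) sums eta_comb_hol' J w A' D' B' z"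
      using eta_comb_hol'_q_expansion[of J A' D' N w B'] J pos N by metis
    have "(\<lambda>n. (2 * \<i> * coef n) * qexp (of_nat n * z / of_nat N)) sums
       ((of_int c * z + of_int d) powi (- 2) * xi0 ?F (mobius (a, b, c, d) z))" if z: "z \<in> upper_half_plane" for z
    proof -
      let ?\<gamma> = "mobius (a, b, c, d)"
      have \<gamma>z: "?\<gamma> z' \<in> upper_half_plane" if "z' \<in> upper_half_plane" for z'
        by (rule mobius_in_upper_half_plane[OF that det])
      have "((\<lambda>z. ?g (?\<gamma> z)) has_field_derivative
          eta_comb_hol' J w A (\<lambda>_. 1) (\<lambda>_. 0) (?\<gamma> z) * (1 / (of_int c * z + of_int d)\<^sup>2)) (at z)"
        using A by (intro DERIV_chain2[OF eta_comb_hol_has_field_derivative] mobius_has_field_derivative \<gamma>z z det) auto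
      \<comment> \<open>The shadow of the pulled-back function is computed twice: by the chain rule
        from \<open>?g\<close> composed with gamma, which produces the factor (c z + d)^-2, and from
        the triangular form, which has the q-expansion.\<close>
      then have "xi0 (eta_comb K J w A' D' B') z =
          2 * \<i> * (eta_comb_hol' J w A (\<lambda>_. 1) (\<lambda>_. 0) (?\<gamma> z) * (1 / (of_int c * z + of_int d)\<^sup>2))"
      proof (rule xi0_twice_Re[OF open_upper_half_plane z, rotated])
        fix u assume u: "u \<in> upper_half_plane"
        show "eta_comb K J w A' D' B' u = ?g (?\<gamma> u) + cnj (?g (?\<gamma> u))"
          using *(2)[OF u] Fg[OF \<gamma>z[OF u]] by (simp only:)
      qed
      moreover have "xi0 (eta_comb K J w A' D' B') z = 2 * \<i> * eta_comb_hol' J w A' D' B' z"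
        by (rule xi0_eta_comb[OF w pos z])
      moreover have "xi0 ?F (?\<gamma> z) = 2 * \<i> * eta_comb_hol' J w A (\<lambda>_. 1) (\<lambda>_. 0) (?\<gamma> z)"
        using A by (intro xi0_eta_comb w \<gamma>z z) auto
      ultimately have "(of_int c * z + of_int d) powi (- 2) * xi0 ?F (?\<gamma> z) = 2 * \<i> * eta_comb_hol' J w A' D' B' z"
        by (simp add: power_int_minus field_simps)
      then show ?thesis using sums_mult[OF coef[OF z], of "2 * \<i>"] by (simp add: mult.assoc)
    qed
    then show "\<exists>h>0. \<exists>coef. \<forall>z\<in>upper_half_plane. (\<lambda>n. coef n * qexp (of_nat n * z / of_nat h)) sums
         ((of_int c * z + of_int d) powi (- 2) * xi0 ?F (mobius (a, b, c, d) z))"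
      by (intro exI[of _ N] conjI exI[of _ "\<lambda>n. 2 * \<i> * coef n"] ballI N)
  qed
  moreover have "partial_x (partial_x ?F) z + partial_y (partial_y ?F) z = 0" if "z \<in> upper_half_plane" for z
    by (rule harmonic_twice_Re[OF open_upper_half_plane that Fg hol])
  ultimately show ?thesis by (simp add: H0_def)
qed

section \<open>The mock modular Eisenstein series\<close>

lemma arith_extend_divide:
  assumes "n > 0" "t > 0"
  shows "arith_extend f (of_nat n / of_nat t) = (if t dvd n then f (n div t) else 0)"
proof (cases "t dvd n")
  case True
  then obtain k where k: "n = t * k" by (elim dvdE)
  then have "(of_nat n / of_nat t :: rat) = of_nat k" using assms by simp
  moreover have "k > 0" using k assms by (intro Nat.gr0I) auto
  ultimately show ?thesis using k assms by (simp add: arith_extend_def)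
next
  case False
  have "(of_nat n / of_nat t :: rat) \<notin> \<int>"
  proof
    assume "(of_nat n / of_nat t :: rat) \<in> \<int>"
    then obtain k where "(of_nat n / of_nat t :: rat) = of_int k" by (elim Ints_cases)
    then have "(of_int (int n) :: rat) = of_int (k * int t)" using assms by (simp add: field_simps)
    then have "int n = k * int t" by (simp only: of_int_eq_iff)
    then have "int t dvd int n" by simp
    with False show False by simp
  qed
  with False show ?thesis by (simp add: arith_extend_def)
qed

lemma divisor_sum_at_sums:
  assumes "k > 0" "norm w < 1"
  shows "(\<lambda>n. divisor_sum_at k n * w ^ n) sums eval_fps divisor_fps (w ^ k)"
proof -
  have "norm (w ^ k) < 1" using assms by (simp add: norm_power power_less_one_iff)
  then show ?thesis
    unfolding divisor_sum_at_def by (intro sums_multiples assms eval_divisor_fps_sums)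
qed

lemma log_euler_sums:
  assumes "k > 0" "norm w < 1"
  shows "(\<lambda>n. divisor_sum_at k n * of_nat k / of_nat n * w ^ n) sums eval_fps log_euler_fps (w ^ k)"
proof -
  have "norm (w ^ k) < 1" using assms by (simp add: norm_power power_less_one_iff)
  then have "ereal (norm (w ^ k)) < fps_conv_radius log_euler_fps"
    by (intro order.strict_trans2[OF _ fps_conv_radius_log_euler_fps]) simp
  then have "(\<lambda>n. of_nat (divisor_sum n) / of_nat n * (w ^ k) ^ n) sums eval_fps log_euler_fps (w ^ k)"
    using sums_eval_fps[of "w ^ k" log_euler_fps] by (simp add: log_euler_fps_def)
  from sums_multiples[OF assms(1) this]
  have "(\<lambda>n. (if k dvd n then of_nat (divisor_sum (n div k)) / of_nat (n div k) else 0) * w ^ n) sums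
      eval_fps log_euler_fps (w ^ k)" .
  also have "(\<lambda>n. (if k dvd n then of_nat (divisor_sum (n div k)) / of_nat (n div k) else 0) * w ^ n) =
      (\<lambda>n. divisor_sum_at k n * of_nat k / of_nat n * w ^ n)"
    using assms(1) by (auto simp: fun_eq_iff divisor_sum_at_def elim!: dvdE)
  finally show ?thesis .
qed

lemma divisor_sum_at_mult:
  assumes "t > 0" "k > 0"
  shows "divisor_sum_at (t * k) n = (if t dvd n then divisor_sum_at k (n div t) else 0)"
proof (cases "t dvd n")
  case True
  then obtain j where "n = t * j" by (elim dvdE)
  then show ?thesis using assms by (simp add: divisor_sum_at_def div_mult2_eq)
next
  case False
  then have "\<not> t * k dvd n" using dvd_mult_left by blast
  with False show ?thesis by (simp add: divisor_sum_at_def)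
qed

section \<open>Weights and constant of the preimage\<close>

text \<open>By xi_0, H (m z) / m becomes - pi / 3 times E2 (m z), and E2^{1_L, 1_M} has coefficient
  pi^2 / (6 M^2) times \<open>level_weight\<close> at E2 (d e z). The quotient of the two factors is
  - pi / (2 M^2).\<close>

definition eta_weight :: "nat \<Rightarrow> nat \<times> nat \<Rightarrow> real" where
  "eta_weight M i = - (pi / (2 * real M ^ 2)) * level_weight M i / real (fst i * snd i)"

abbreviation eta_index :: "nat \<Rightarrow> nat \<Rightarrow> ((nat \<times> nat) \<times> bool) set" where
  "eta_index L M \<equiv> level_divisors L M \<times> UNIV"

text \<open>The two booleans stand for the two terms of \<open>H (d e z) - H (t d e z)\<close>.\<close>

definition eta_sign_weight :: "nat \<Rightarrow> (nat \<times> nat) \<times> bool \<Rightarrow> real" where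
  "eta_sign_weight M = (\<lambda>(i, b). (if b then 1 else - 1) * eta_weight M i)"

definition eta_scale :: "nat \<Rightarrow> (nat \<times> nat) \<times> bool \<Rightarrow> nat" where
  "eta_scale t = (\<lambda>(i, b). (if b then 1 else t) * (fst i * snd i))"

lemma sum_eta_index:
  fixes f :: "(nat \<times> nat) \<times> bool \<Rightarrow> 'a :: comm_monoid_add"
  shows "(\<Sum>j\<in>eta_index L M. f j) = (\<Sum>i\<in>level_divisors L M. f (i, True) + f (i, False))"
  unfolding sum.cartesian_product'[of _ "level_divisors L M"] by (simp add: UNIV_bool add.commute)

locale mock_eisenstein =
  fixes L M t :: nat
  assumes L: "L \<ge> 1" and M: "M \<ge> 1" and t: "t \<ge> 1"
begin

lemma index_pos: "fst i * snd i > 0" if "i \<in> level_divisors L M"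
  using that L M by (auto intro!: Nat.gr0I)

lemma finite_level_divisors: "finite (level_divisors L M)"
  using L M by simp

lemma sum_eta_sign_weight: "sum (eta_sign_weight M) (eta_index L M) = 0"
  by (simp add: sum_eta_index eta_sign_weight_def)

lemma eta_scale_pos: "eta_scale t j > 0" if "j \<in> eta_index L M"
  using that index_pos[of "fst j"] t by (auto simp: eta_scale_def split: if_splits)

lemma eta_scale_dvd: "eta_scale t j dvd t * L * M" if "j \<in> eta_index L M"
proof -
  obtain d e b where j: "j = ((d, e), b)" by (metis surj_pair)
  with that have "d dvd M" "e dvd L" by auto
  then have "d * e dvd M * L" by (intro mult_dvd_mono)
  then have "t * (d * e) dvd t * (M * L)" "d * e dvd t * (M * L)" by auto
  then show ?thesis by (auto simp: eta_scale_def j mult_ac)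
qed

lemma eta_weight_scale:
  assumes "i \<in> level_divisors L M"
  shows "eta_weight M i * real (fst i * snd i) = - (pi / (2 * real M ^ 2)) * level_weight M i"
  using index_pos[OF assms] by (simp add: eta_weight_def)

text \<open>The constant of \<open>eta_comb\<close> is real; taking the real part loses nothing, as
  the Euler products are real.\<close>

definition c0_const :: real where
  "c0_const = Re (c0_plus L M t 0)"

lemma c0_plus_0: "c0_plus L M t 0 = of_real c0_const"
proof -
  have "euler_prod n \<in> \<real>" for n
    unfolding euler_prod_def by (intro prod_in_Reals) auto
  then have "c0_plus L M t 0 \<in> \<real>"
    unfolding c0_plus_def by (auto intro!: Reals_mult Reals_divide)
  then show ?thesis unfolding c0_const_def by (simp add: of_real_Re)
qed

text \<open>Chosen such that the constant term is exactly \<open>c0_plus L M t 0\<close>.\<close>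

definition preimage_const :: real where
  "preimage_const = c0_const - (\<Sum>j\<in>eta_index L M. eta_sign_weight M j * ln (real (eta_scale t j)))"

definition harmonic_preimage :: "complex \<Rightarrow> complex" where
  "harmonic_preimage = eta_comb preimage_const (eta_index L M) (eta_sign_weight M) (eta_scale t) (\<lambda>_. 1) (\<lambda>_. 0)"

lemma harmonic_preimage_in_H0: "harmonic_preimage \<in> H0 (t * L * M) (trivial_character (t * L * M))"
  unfolding harmonic_preimage_def
  by (rule eta_comb_in_H0)
     (use finite_level_divisors sum_eta_sign_weight eta_scale_pos eta_scale_dvd L M t in auto)

section \<open>The shadow\<close>

lemma sigma1_sums:
  assumes "norm w < 1"
  shows "(\<lambda>n. sigma1_triv L M n * w ^ n) sums
    (\<Sum>i\<in>level_divisors L M. of_real (level_weight M i) * eval_fps divisor_fps (w ^ (fst i * snd i)))"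
proof -
  have "(\<lambda>n. \<Sum>i\<in>level_divisors L M. of_real (level_weight M i) * (divisor_sum_at (fst i * snd i) n * w ^ n)) sums
    (\<Sum>i\<in>level_divisors L M. of_real (level_weight M i) * eval_fps divisor_fps (w ^ (fst i * snd i)))"
    using index_pos assms by (intro sums_sum sums_mult divisor_sum_at_sums) auto
  then show ?thesis
    unfolding sigma1_triv_eq[OF L M] by (simp add: sum_distrib_right case_prod_unfold mult.assoc)
qed

lemma E2_eq:
  assumes "z \<in> upper_half_plane"
  shows "E2 L M z = C2 L M
     - of_real pi / (2 * of_nat M * of_real (Im z)) * euler_prod M * euler_prod L
     - 4 * of_real pi ^ 2 / of_nat M ^ 2 * (\<Sum>i\<in>level_divisors L M.
         of_real (level_weight M i) * eval_fps divisor_fps (qexp z ^ (fst i * snd i)))"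
proof -
  have "(\<lambda>n. sigma1_triv L M (Suc n) * qexp z ^ Suc n) sums
    (\<Sum>i\<in>level_divisors L M. of_real (level_weight M i) * eval_fps divisor_fps (qexp z ^ (fst i * snd i)))"
    using sigma1_sums[OF norm_qexp_less_1[OF assms]] by (subst sums_Suc_iff) (simp add: sigma1_def)
  then show ?thesis unfolding E2_def by (simp add: sums_iff)
qed

lemma xi0_harmonic_preimage:
  assumes z: "z \<in> upper_half_plane"
  shows "xi0 harmonic_preimage z = E2t L M t z"
proof -
  define \<psi> where "\<psi> k = eval_fps divisor_fps (qexp z ^ k)" for k
  define m where "m i = fst i * snd i" for i :: "nat \<times> nat"
  define l where "l i = complex_of_real (level_weight M i)" for i
  define c where "c = complex_of_real pi ^ 2 / (6 * of_nat M ^ 2)"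
  have tz: "of_nat t * z \<in> upper_half_plane" using z t by (simp add: upper_half_plane_def)
  have "xi0 harmonic_preimage z = 2 * \<i> * eta_comb_hol' (eta_index L M) (eta_sign_weight M) (eta_scale t) (\<lambda>_. 1) (\<lambda>_. 0) z"
    unfolding harmonic_preimage_def by (rule xi0_eta_comb) (use sum_eta_sign_weight eta_scale_pos z in auto)
  also have "\<dots> = (\<Sum>j\<in>eta_index L M. of_real (eta_sign_weight M j) * of_nat (eta_scale t j) *
      (\<i> * log_eta4' (of_nat (eta_scale t j) * z)))"
    by (simp add: eta_comb_hol'_def sum_distrib_left mult_ac)
  also have "\<dots> = (\<Sum>i\<in>level_divisors L M. c * (l i * ((1 - 24 * \<psi> (m i)) - of_nat t * (1 - 24 * \<psi> (t * m i)))))"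
    unfolding sum_eta_index
  proof (rule sum.cong)
    fix i assume i: "i \<in> level_divisors L M"
    have lp: "\<i> * log_eta4' (of_nat k * z) = - (of_real pi / 3) * (1 - 24 * \<psi> k)" for k
    proof -
      have "\<i> * (a * \<i> / 3 * x) = - (a / 3) * x" for a x
        by (simp add: complex_eq_iff field_simps)
      then show ?thesis by (simp only: log_eta4'_def \<psi>_def qexp_of_nat_mult)
    qed
    have "of_real (eta_weight M i) * of_nat (m i) = complex_of_real (eta_weight M i * real (fst i * snd i))"
      by (simp add: m_def)
    also have "\<dots> = - (of_real pi / (2 * of_nat M ^ 2)) * l i"
      unfolding eta_weight_scale[OF i] by (simp add: l_def)
    finally have wm: "of_real (eta_weight M i) * of_nat (m i) = - (of_real pi / (2 * of_nat M ^ 2)) * l i" .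
    have "of_real (eta_sign_weight M (i, True)) * of_nat (eta_scale t (i, True)) * (\<i> * log_eta4' (of_nat (eta_scale t (i, True)) * z)) +
      of_real (eta_sign_weight M (i, False)) * of_nat (eta_scale t (i, False)) * (\<i> * log_eta4' (of_nat (eta_scale t (i, False)) * z)) =
      (of_real (eta_weight M i) * of_nat (m i)) * (- (of_real pi / 3)) * ((1 - 24 * \<psi> (m i)) - of_nat t * (1 - 24 * \<psi> (t * m i)))"
      unfolding lp by (simp add: eta_sign_weight_def eta_scale_def m_def algebra_simps)
    also have "\<dots> = c * (l i * ((1 - 24 * \<psi> (m i)) - of_nat t * (1 - 24 * \<psi> (t * m i))))"
      unfolding wm by (simp add: c_def power2_eq_square)
    finally show "of_real (eta_sign_weight M (i, True)) * of_nat (eta_scale t (i, True)) * (\<i> * log_eta4' (of_nat (eta_scale t (i, True)) * z)) +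
      of_real (eta_sign_weight M (i, False)) * of_nat (eta_scale t (i, False)) * (\<i> * log_eta4' (of_nat (eta_scale t (i, False)) * z)) =
      c * (l i * ((1 - 24 * \<psi> (m i)) - of_nat t * (1 - 24 * \<psi> (t * m i))))" .
  qed auto
  also have "\<dots> = (1 - of_nat t) * (c * (\<Sum>i\<in>level_divisors L M. l i)) -
      24 * c * ((\<Sum>i\<in>level_divisors L M. l i * \<psi> (m i)) - of_nat t * (\<Sum>i\<in>level_divisors L M. l i * \<psi> (t * m i)))"
    unfolding sum_distrib_left sum_subtractf[symmetric] by (intro sum.cong) (auto simp: algebra_simps)
  also have "c * (\<Sum>i\<in>level_divisors L M. l i) = C2 L M"
    unfolding C2_eq[OF L M] c_def l_def by simp
  also have "24 * c = 4 * of_real pi ^ 2 / of_nat M ^ 2" by (simp add: c_def)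
  also have "(1 - of_nat t) * C2 L M - 4 * of_real pi ^ 2 / of_nat M ^ 2 *
      ((\<Sum>i\<in>level_divisors L M. l i * \<psi> (m i)) - of_nat t * (\<Sum>i\<in>level_divisors L M. l i * \<psi> (t * m i))) = E2t L M t z"
  proof -
    \<comment> \<open>Because Im (t z) = t Im z, the non-holomorphic terms of E2 (z) and t E2 (t z)
      coincide and cancel.\<close>
    have "of_nat t * (of_real pi / (2 * of_nat M * of_real (Im (of_nat t * z))) * euler_prod M * euler_prod L) =
        of_real pi / (2 * of_nat M * of_real (Im z)) * euler_prod M * euler_prod L"
      using t by (simp add: mult.assoc)
    then have "(1 - of_nat t) * C - k * (S - of_nat t * S') =
        (C - of_real pi / (2 * of_nat M * of_real (Im z)) * euler_prod M * euler_prod L - k * S) -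
        of_nat t * (C - of_real pi / (2 * of_nat M * of_real (Im (of_nat t * z))) * euler_prod M * euler_prod L - k * S')"
      for C k S S'
      by (simp only: right_diff_distrib left_diff_distrib) (simp add: mult_ac)
    then show ?thesis
      unfolding E2t_def E2_eq[OF z] E2_eq[OF tz] l_def \<psi>_def m_def
      by (simp only: qexp_of_nat_mult flip: power_mult)
  qed
  finally show ?thesis .
qed

section \<open>Fourier expansion of the preimage\<close>

text \<open>The terms of positive exponent in the holomorphic part. The factor -2 is half of the -4
  in \<open>log_eta4\<close>, because the preimage is twice the real part of its holomorphic
  half.\<close>

definition positive_part :: "complex \<Rightarrow> complex" where
  "positive_part w = (\<Sum>j\<in>eta_index L M. of_real (- 2 * eta_sign_weight M j) * eval_fps log_euler_fps (w ^ eta_scale t j))"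

text \<open>The coefficient of w^n in \<open>eval_fps log_euler_fps (w ^ k)\<close> is (k / n)
  sigma(n / k). For k = d e or t d e, the factor d e cancels the denominator of
  \<open>eta_weight\<close>, and -2 times - pi / (2 M^2) is the pi / M^2 in
  \<open>c0_plus\<close>.\<close>

lemma c0_plus_sums:
  assumes "norm w < 1"
  shows "(\<lambda>n. c0_plus L M t n * w ^ n) sums (of_real c0_const + positive_part w)"
proof -
  have "(\<lambda>n. \<Sum>j\<in>eta_index L M. of_real (- 2 * eta_sign_weight M j) *
      (divisor_sum_at (eta_scale t j) n * of_nat (eta_scale t j) / of_nat n * w ^ n)) sums positive_part w"
    unfolding positive_part_def using eta_scale_pos assms by (intro sums_sum sums_mult log_euler_sums) auto
  also have "(\<lambda>n. \<Sum>j\<in>eta_index L M. of_real (- 2 * eta_sign_weight M j) *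
      (divisor_sum_at (eta_scale t j) n * of_nat (eta_scale t j) / of_nat n * w ^ n)) =
      (\<lambda>n. if n = 0 then 0 else c0_plus L M t n * w ^ n)"
  proof
    fix n :: nat
    show "(\<Sum>j\<in>eta_index L M. of_real (- 2 * eta_sign_weight M j) *
      (divisor_sum_at (eta_scale t j) n * of_nat (eta_scale t j) / of_nat n * w ^ n)) =
      (if n = 0 then 0 else c0_plus L M t n * w ^ n)"
    proof (cases "n = 0")
      case False
      define m where "m i = fst i * snd i" for i :: "nat \<times> nat"
      define l where "l i = complex_of_real (level_weight M i)" for i
      define D where "D k = divisor_sum_at k n" for k
      have "(\<Sum>j\<in>eta_index L M. of_real (- 2 * eta_sign_weight M j) *
          (divisor_sum_at (eta_scale t j) n * of_nat (eta_scale t j) / of_nat n * w ^ n)) =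
          (\<Sum>i\<in>level_divisors L M. (of_real pi / of_nat M ^ 2 * (1 / of_nat n) * w ^ n) * (l i * (D (m i) - of_nat t * D (t * m i))))"
        unfolding sum_eta_index
      proof (rule sum.cong)
        fix i assume i: "i \<in> level_divisors L M"
        have "of_real (eta_weight M i) * of_nat (m i) = complex_of_real (eta_weight M i * real (fst i * snd i))"
          by (simp add: m_def)
        also have "\<dots> = - (of_real pi / (2 * of_nat M ^ 2)) * l i"
          unfolding eta_weight_scale[OF i] by (simp add: l_def)
        finally have wm: "of_real (eta_weight M i) * of_nat (m i) = - (of_real pi / (2 * of_nat M ^ 2)) * l i" .
        have "of_real (- 2 * eta_sign_weight M (i, True)) *
           (divisor_sum_at (eta_scale t (i, True)) n * of_nat (eta_scale t (i, True)) / of_nat n * w ^ n) +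
           of_real (- 2 * eta_sign_weight M (i, False)) *
           (divisor_sum_at (eta_scale t (i, False)) n * of_nat (eta_scale t (i, False)) / of_nat n * w ^ n) =
           (of_real (eta_weight M i) * of_nat (m i)) * (- 2) * (1 / of_nat n * w ^ n) * (D (m i) - of_nat t * D (t * m i))"
          by (simp add: eta_sign_weight_def eta_scale_def m_def D_def diff_divide_distrib algebra_simps)
        also have "\<dots> = (of_real pi / of_nat M ^ 2 * (1 / of_nat n) * w ^ n) * (l i * (D (m i) - of_nat t * D (t * m i)))"
          unfolding wm by simp
        finally show "of_real (- 2 * eta_sign_weight M (i, True)) *
           (divisor_sum_at (eta_scale t (i, True)) n * of_nat (eta_scale t (i, True)) / of_nat n * w ^ n) +
           of_real (- 2 * eta_sign_weight M (i, False)) *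
           (divisor_sum_at (eta_scale t (i, False)) n * of_nat (eta_scale t (i, False)) / of_nat n * w ^ n) =
           (of_real pi / of_nat M ^ 2 * (1 / of_nat n) * w ^ n) * (l i * (D (m i) - of_nat t * D (t * m i)))" .
      qed auto
      also have "\<dots> = (of_real pi / of_nat M ^ 2 * (1 / of_nat n) * w ^ n) *
          ((\<Sum>i\<in>level_divisors L M. l i * D (m i)) - of_nat t * (\<Sum>i\<in>level_divisors L M. l i * D (t * m i)))"
        unfolding sum_distrib_left sum_subtractf[symmetric] by (intro sum.cong) (auto simp: algebra_simps)
      also have "(\<Sum>i\<in>level_divisors L M. l i * D (m i)) = sigma1_triv L M n"
        unfolding sigma1_triv_eq[OF L M] by (simp add: l_def D_def m_def case_prod_unfold)
      also have "(\<Sum>i\<in>level_divisors L M. l i * D (t * m i)) = arith_extend (sigma1_triv L M) (of_nat n / of_nat t)"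
      proof -
        have "(\<Sum>i\<in>level_divisors L M. l i * D (t * m i)) = (\<Sum>i\<in>level_divisors L M. l i * (if t dvd n then divisor_sum_at (m i) (n div t) else 0))"
          using t index_pos by (intro sum.cong) (auto simp: D_def m_def divisor_sum_at_mult)
        also have "\<dots> = (if t dvd n then sigma1_triv L M (n div t) else 0)"
          unfolding sigma1_triv_eq[OF L M] by (auto simp: l_def m_def case_prod_unfold)
        finally show ?thesis using False t by (simp add: arith_extend_divide)
      qed
      finally show ?thesis using False by (simp add: c0_plus_def)
    qed simp
  qed
  finally have 1: "(\<lambda>n. if n = 0 then 0 else c0_plus L M t n * w ^ n) sums positive_part w" .
  have "(\<lambda>n. if n = 0 then c0_plus L M t 0 else 0) sums c0_plus L M t 0"
    using sums_single[of 0 "\<lambda>_. c0_plus L M t 0"] by simp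
  from sums_add[OF this 1] show ?thesis
    unfolding c0_plus_0[symmetric] by (rule sums_cong[THEN iffD1, rotated]) auto
qed

lemma fps_conv_radius_c0_plus: "fps_conv_radius (Abs_fps (c0_plus L M t)) \<ge> 1"
  unfolding fps_conv_radius_def
proof (rule conv_radius_geI_ex')
  fix r :: real assume "0 < r" "ereal r < 1"
  then have "norm (complex_of_real r) < 1" by simp
  from c0_plus_sums[OF this] show "summable (\<lambda>n. fps_nth (Abs_fps (c0_plus L M t)) n * of_real r ^ n)"
    by (simp add: sums_iff)
qed

text \<open>The linear term collects the real parts of pi i k z / 3 from \<open>log_eta4\<close>.
  Its coefficient is the constant term (1 - t) \<open>C2\<close> of the shadow, as the convention
  \<open>beta0 0 y = - y\<close> demands.\<close>

lemma harmonic_preimage_eq: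
  assumes z: "z \<in> upper_half_plane"
  shows "harmonic_preimage z = of_real c0_const + positive_part (qexp z) + cnj (positive_part (qexp z)) + (1 - of_nat t) * C2 L M * of_real (Im z)"
proof -
  define S where "S = (\<Sum>j\<in>eta_index L M. eta_sign_weight M j * real (eta_scale t j))"
  define R where "R = (\<Sum>j\<in>eta_index L M. eta_sign_weight M j * Re (eval_fps log_euler_fps (qexp z ^ eta_scale t j)))"
  have re: "Re (log_eta4 (of_nat k * z)) = - (pi / 3) * real k * Im z - 4 * Re (eval_fps log_euler_fps (qexp z ^ k))" for k
    by (simp add: log_eta4_def qexp_of_nat_mult)
  have "harmonic_preimage z = of_real (c0_const + (\<Sum>j\<in>eta_index L M. eta_sign_weight M j * Re (log_eta4 (of_nat (eta_scale t j) * z))))"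
    unfolding harmonic_preimage_def
    by (subst eta_comb_eq) (use sum_eta_sign_weight eta_scale_pos z in \<open>auto simp: preimage_const_def\<close>)
  also have "(\<Sum>j\<in>eta_index L M. eta_sign_weight M j * Re (log_eta4 (of_nat (eta_scale t j) * z))) =
      - (pi / 3) * Im z * S - 4 * R"
    unfolding re S_def R_def sum_distrib_left sum_subtractf[symmetric]
    by (intro sum.cong) (auto simp: algebra_simps)
  also have "S = (1 - real t) * (- (pi / (2 * real M ^ 2))) * (\<Sum>i\<in>level_divisors L M. level_weight M i)"
    unfolding S_def sum_eta_index sum_distrib_left
  proof (rule sum.cong)
    fix i assume i: "i \<in> level_divisors L M"
    have "eta_sign_weight M (i, True) * real (eta_scale t (i, True)) + eta_sign_weight M (i, False) * real (eta_scale t (i, False)) =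
       (1 - real t) * (eta_weight M i * real (fst i * snd i))"
      by (simp add: eta_sign_weight_def eta_scale_def algebra_simps)
    then show "eta_sign_weight M (i, True) * real (eta_scale t (i, True)) + eta_sign_weight M (i, False) * real (eta_scale t (i, False)) =
       (1 - real t) * (- (pi / (2 * real M ^ 2))) * level_weight M i"
      unfolding eta_weight_scale[OF i] by simp
  qed auto
  finally have 1: "harmonic_preimage z = of_real (c0_const + (1 - real t) * (pi\<^sup>2 / (6 * real M ^ 2) * (\<Sum>i\<in>level_divisors L M. level_weight M i)) * Im z - 4 * R)"
    by (simp add: power2_eq_square mult_ac)
  have "positive_part (qexp z) + cnj (positive_part (qexp z)) = of_real (2 * Re (positive_part (qexp z)))"
    by (rule complex_add_cnj)
  also have "Re (positive_part (qexp z)) = - 2 * R"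
    by (simp add: positive_part_def R_def sum_distrib_left mult.assoc sum_negf)
  finally have "positive_part (qexp z) + cnj (positive_part (qexp z)) = of_real (- 4 * R)" by simp
  then show ?thesis unfolding 1 C2_eq[OF L M] by (simp add: algebra_simps)
qed

lemma beta0_pos:
  assumes "n > 0"
  shows "beta0 n y = exp (- 4 * pi * real n * y) / (4 * pi * real n)"
proof -
  have "((\<lambda>u. exp (- (4 * pi * real n) * u)) has_integral exp (- (4 * pi * real n) * y) / (4 * pi * real n)) {y..}"
    using assms by (intro has_integral_exp_minus_to_infinity) auto
  then show ?thesis using assms by (simp add: beta0_def integral_unique)
qed

lemma is_holomorphic_part_harmonic_preimage: "is_holomorphic_part (G0 L M t) harmonic_preimage"
  unfolding is_holomorphic_part_def
proof (intro conjI exI ballI)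
  \<comment> \<open>These are the Fourier coefficients of the shadow. For n > 0 they are forced by
    the preimage being real: its antiholomorphic terms are the conjugates of those in
    \<open>c0_plus\<close>, and \<open>beta0 n\<close> brings the denominator 4 pi n.\<close>
  define c where "c n = (if n = 0 then (1 - of_nat t) * C2 L M else - 4 * of_real pi * of_nat n * c0_plus L M t n)" for n
  have C2r: "cnj (C2 L M) = C2 L M" unfolding C2_eq[OF L M] by simp
  show "1 \<le> fls_conv_radius (G0 L M t)" unfolding G0_def using fps_conv_radius_c0_plus by simp
  fix z assume z: "z \<in> upper_half_plane"
  define q where "q = qexp z"
  have q: "norm q < 1" "q \<noteq> 0" using norm_qexp_less_1[OF z] by (simp_all add: q_def)
  \<comment> \<open>The exponential is |q|^(2 n), which is q^n times its conjugate.\<close>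
  have qq: "of_real (exp (- 4 * pi * real n * Im z)) * q powi (- int n) = cnj q ^ n" for n
  proof -
    have "cnj q * q = of_real ((norm q)\<^sup>2)" by (simp only: complex_norm_square mult.commute)
    also have "(norm q)\<^sup>2 = exp (- 4 * pi * Im z)" by (simp add: q_def norm_qexp flip: exp_double)
    finally have "(cnj q * q) ^ n = of_real (exp (- 4 * pi * Im z) ^ n)" by simp
    also have "exp (- 4 * pi * Im z) ^ n = exp (- 4 * pi * real n * Im z)"
      by (simp add: mult_ac flip: exp_of_nat_mult)
    finally show ?thesis using q(2) by (simp add: power_int_minus power_mult_distrib field_simps)
  qed
  have "(\<lambda>n. cnj (c0_plus L M t n * q ^ n)) sums cnj (of_real c0_const + positive_part q)"
    by (intro sums_cnj[THEN iffD2] c0_plus_sums q)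
  from sums_minus[OF this] have 1: "(\<lambda>n. - cnj (c0_plus L M t n * q ^ n)) sums (- of_real c0_const - cnj (positive_part q))" by simp
  \<comment> \<open>A correction at n = 0: the constant \<open>c0_const\<close> belongs to the
    holomorphic part alone, so its conjugate copy is removed and replaced by the term of
    \<open>beta0 0\<close>.\<close>
  have "(\<lambda>n. if n = 0 then of_real c0_const - (1 - of_nat t) * C2 L M * of_real (Im z) else 0) sums
      (of_real c0_const - (1 - of_nat t) * C2 L M * of_real (Im z))"
    using sums_single[of 0 "\<lambda>_. of_real c0_const - (1 - of_nat t) * C2 L M * of_real (Im z)"] by simp
  from sums_add[OF 1 this]
  have "(\<lambda>n. - cnj (c0_plus L M t n * q ^ n) + (if n = 0 then of_real c0_const - (1 - of_nat t) * C2 L M * of_real (Im z) else 0)) sums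
      (- cnj (positive_part q) - (1 - of_nat t) * C2 L M * of_real (Im z))"
    by simp
  also have "(\<lambda>n. - cnj (c0_plus L M t n * q ^ n) + (if n = 0 then of_real c0_const - (1 - of_nat t) * C2 L M * of_real (Im z) else 0)) =
      (\<lambda>n. cnj (c n) * of_real (beta0 n (Im z)) * q powi (- int n))"
  proof
    fix n
    show "- cnj (c0_plus L M t n * q ^ n) + (if n = 0 then of_real c0_const - (1 - of_nat t) * C2 L M * of_real (Im z) else 0) =
       cnj (c n) * of_real (beta0 n (Im z)) * q powi (- int n)"
    proof (cases "n = 0")
      case True
      then show ?thesis by (simp add: c_def beta0_def c0_plus_0 C2r algebra_simps)
    next
      case False
      then have "cnj (c n) * of_real (beta0 n (Im z)) = - cnj (c0_plus L M t n) * of_real (exp (- 4 * pi * real n * Im z))"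
        by (simp add: c_def beta0_pos)
      then have "cnj (c n) * of_real (beta0 n (Im z)) * q powi (- int n) =
          - cnj (c0_plus L M t n) * (of_real (exp (- 4 * pi * real n * Im z)) * q powi (- int n))"
        by (simp only: mult.assoc)
      then show ?thesis unfolding qq using False by simp
    qed
  qed
  finally have s: "(\<lambda>n. cnj (c n) * of_real (beta0 n (Im z)) * q powi (- int n)) sums
      (- cnj (positive_part q) - (1 - of_nat t) * C2 L M * of_real (Im z))" .
  then show "summable (\<lambda>n. cnj (c n) * of_real (beta0 n (Im z)) * qexp z powi (- int n))"
    by (simp add: sums_iff q_def)
  have "eval_fls (G0 L M t) q = of_real c0_const + positive_part q"
  proof -
    have "eval_fls (G0 L M t) q = eval_fps (Abs_fps (c0_plus L M t)) q"
      unfolding G0_def using fps_conv_radius_c0_plus q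
      by (intro eval_fps_to_fls order.strict_trans2[OF _ fps_conv_radius_c0_plus]) simp
    also have "\<dots> = of_real c0_const + positive_part q"
      using c0_plus_sums[OF q(1)] by (simp add: eval_fps_def sums_iff)
    finally show ?thesis .
  qed
  then show "harmonic_preimage z = eval_fls (G0 L M t) (qexp z) - (\<Sum>n. cnj (c n) * of_real (beta0 n (Im z)) * qexp z powi (- int n))"
    using s unfolding harmonic_preimage_eq[OF z] by (simp add: sums_iff q_def)
qed

end

theorem theorem1p2:
  fixes L M t :: nat
  assumes "L \<ge> 1" and "M \<ge> 1" and "t \<ge> 1"
  shows "mock_modular_form_weight0 (t * L * M) (trivial_character (t * L * M))
           (G0 L M t) (E2t L M t)"
proof -
  interpret mock_eisenstein L M t using assms by unfold_locales
  show ?thesis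
    unfolding mock_modular_form_weight0_def
    using harmonic_preimage_in_H0 is_holomorphic_part_harmonic_preimage xi0_harmonic_preimage by blast
qed

end
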